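(* Let $T>0$, let $\{B_t\}_{t\in[0,T]}$ be a one-dimensional Brownian motion on a filtered probability space $(\Omega,\mathcal F,\{\mathcal F_t\}_{t\in[0,T]},\mathbb P)$, let $h:[0,T]\times\mathbb R\to\mathbb R_+$ be a Hurst function with parameters $(h_*,h^* )$, and let $g$ be an $\{\mathcal F_t\}$-adapted, $\mathbb R$-valued continuous process such that for some $\delta>0$ and for any $p\ge2$ $$\mathbb E\Big[\sup_{t\in[0,T]}|g(t)|^p\Big]<\infty,\qquad \mathbb E\big[|g(t)-g(s)|^p\big]\le C_{T,p}|t-s|^{\delta p}\quad\text{for all } s,t\in[0,T],$$ with a constant $C_{T,p}$. Let $\{X_t^h\}_{t\in[0,T]}$ be the self-exciting multifractional (SEM) process, i.e. the unique measurable, $\{\mathcal F_t\}$-adapted process satisfying $$X_t^h=g(t)+\int_0^t (t-s)^{h(t,X_s^h)-\frac12}\,dB_s,\qquad t\in[0,T].$$ Then there exists a set of paths $\mathcal N\subset\Omega$ with $\mathbb P(\mathcal N)=0$ such that for all $\omega\in\mathcal N^c$ the path $t\mapsto X^h_t(\omega)$ is $\alpha$-Hölder continuous for any $\alpha\in(0,h_*\wedge\delta)$. In particular, $$|X_t^h(\omega)-X_s^h(\omega)|\le C(\omega)|t-s|^\alpha,\qquad s,t\in[0,T],\ \omega\in\mathcal N^c .$$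
   Context: Hurst function: $h:[0,T]\times\mathbb R\to\mathbb R_+$ is a Hurst function with parameters $(h_*,h^* )$, $h_*\le h^*$, if $h(t,x)\in[h_*,h^*]\subset(0,1)$ for all $(t,x)\in[0,T]\times\mathbb R$ and there is $C>0$ with $|h(t,x)-h(t,y)|\le C|x-y|$ and $|h(t,x)-h(t',x)|\le C|t-t'|$ for all $x,y\in\mathbb R$, $t,t'\in[0,T]$. Notation: $a\wedge b=\min(a,b)$.
   Formalization: The equation determines X only up to modification, so the Hölder property is proved for a modification of X that is again a measurable adapted solution, and for X itself whenever X has almost surely continuous paths; an arbitrary solution can have discontinuous paths. *)

theory Defs
  imports "HOL-Probability.Probability"
begin

section \<open>Processes on a bounded time interval\<close>

text \<open>
  Processes and filtrations are total functions of a real time parameter; only their values at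
  times in \<open>{0..T}\<close> matter. No completeness or right-continuity of the filtration is required.
\<close>

definition filtration_on :: "'a measure \<Rightarrow> real \<Rightarrow> (real \<Rightarrow> 'a measure) \<Rightarrow> bool" where
  "filtration_on M T F \<longleftrightarrow>
     (\<forall>t\<in>{0..T}. subalgebra M (F t)) \<and>
     (\<forall>s t. 0 \<le> s \<and> s \<le> t \<and> t \<le> T \<longrightarrow> sets (F s) \<subseteq> sets (F t))"

definition measurable_process :: "'a measure \<Rightarrow> real \<Rightarrow> (real \<Rightarrow> 'a \<Rightarrow> real) \<Rightarrow> bool" where
  "measurable_process M T X \<longleftrightarrow>
     (\<lambda>(t, \<omega>). X t \<omega>) \<in> borel_measurable (restrict_space borel {0..T} \<Otimes>\<^sub>M M)"

definition adapted_process :: "(real \<Rightarrow> 'a measure) \<Rightarrow> real \<Rightarrow> (real \<Rightarrow> 'a \<Rightarrow> real) \<Rightarrow> bool" where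
  "adapted_process F T X \<longleftrightarrow> (\<forall>t\<in>{0..T}. X t \<in> borel_measurable (F t))"

text \<open>Continuity of the paths is only required almost surely.\<close>

definition continuous_process :: "'a measure \<Rightarrow> real \<Rightarrow> (real \<Rightarrow> 'a \<Rightarrow> real) \<Rightarrow> bool" where
  "continuous_process M T X \<longleftrightarrow> (AE \<omega> in M. continuous_on {0..T} (\<lambda>t. X t \<omega>))"

definition modification_of ::
  "'a measure \<Rightarrow> real \<Rightarrow> (real \<Rightarrow> 'a \<Rightarrow> real) \<Rightarrow> (real \<Rightarrow> 'a \<Rightarrow> real) \<Rightarrow> bool" where
  "modification_of M T X Y \<longleftrightarrow> (\<forall>t\<in>{0..T}. AE \<omega> in M. Y t \<omega> = X t \<omega>)"

definition holder_on :: "real \<Rightarrow> real set \<Rightarrow> (real \<Rightarrow> real) \<Rightarrow> bool" where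
  "holder_on \<alpha> S f \<longleftrightarrow> (\<exists>C. \<forall>s\<in>S. \<forall>t\<in>S. \<bar>f t - f s\<bar> \<le> C * \<bar>t - s\<bar> powr \<alpha>)"

definition brownian_motion ::
  "'a measure \<Rightarrow> (real \<Rightarrow> 'a measure) \<Rightarrow> real \<Rightarrow> (real \<Rightarrow> 'a \<Rightarrow> real) \<Rightarrow> bool" where
  "brownian_motion M F T B \<longleftrightarrow>
     adapted_process F T B \<and>
     continuous_process M T B \<and>
     (AE \<omega> in M. B 0 \<omega> = 0) \<and>
     (\<forall>s t. 0 \<le> s \<and> s < t \<and> t \<le> T \<longrightarrow>
        distributed M lborel (\<lambda>\<omega>. B t \<omega> - B s \<omega>)
          (\<lambda>x. ennreal (normal_density 0 (sqrt (t - s)) x)) \<and>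
        prob_space.indep_set M (sets (F s))
          (sets (vimage_algebra (space M) (\<lambda>\<omega>. B t \<omega> - B s \<omega>) borel)))"

section \<open>The It\^o integral\<close>

text \<open>
  An elementary process on \<open>[0,t]\<close> is given by a partition \<open>0 = p 0 < \<dots> < p n = t\<close> and bounded
  coefficients \<open>\<xi> i\<close>, measurable at the left end point \<open>p i\<close>.
\<close>

definition elementary_data ::
  "(real \<Rightarrow> 'a measure) \<Rightarrow> real \<Rightarrow> nat \<Rightarrow> (nat \<Rightarrow> real) \<Rightarrow> (nat \<Rightarrow> 'a \<Rightarrow> real) \<Rightarrow> bool" where
  "elementary_data F t n p \<xi> \<longleftrightarrow>
     p 0 = 0 \<and> p n = t \<and> (\<forall>i<n. p i < p (Suc i)) \<and>
     (\<forall>i<n. \<xi> i \<in> borel_measurable (F (p i)) \<and>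
            (\<exists>K. \<forall>\<omega>\<in>space (F (p i)). \<bar>\<xi> i \<omega>\<bar> \<le> K))"

definition elementary_process ::
  "nat \<Rightarrow> (nat \<Rightarrow> real) \<Rightarrow> (nat \<Rightarrow> 'a \<Rightarrow> real) \<Rightarrow> real \<Rightarrow> 'a \<Rightarrow> real" where
  "elementary_process n p \<xi> s \<omega> = (\<Sum>i<n. \<xi> i \<omega> * indicator {p i<..p (Suc i)} s)"

definition elementary_integral ::
  "(real \<Rightarrow> 'a \<Rightarrow> real) \<Rightarrow> nat \<Rightarrow> (nat \<Rightarrow> real) \<Rightarrow> (nat \<Rightarrow> 'a \<Rightarrow> real) \<Rightarrow> 'a \<Rightarrow> real" where
  "elementary_integral B n p \<xi> \<omega> = (\<Sum>i<n. \<xi> i \<omega> * (B (p (Suc i)) \<omega> - B (p i) \<omega>))"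

text \<open>
  \<open>has_ito_integral M F B t f I\<close> states that the random variable \<open>I\<close> is a version of
  \<open>\<integral>\<^sub>0\<^sup>t f\<^sub>s dB\<^sub>s\<close>: the integrand \<open>f\<close> is approximated by elementary processes in \<open>L\<^sup>2\<close> on
  \<open>[0,t] \<times> \<Omega>\<close>, and \<open>I\<close> is the \<open>L\<^sup>2\<close> limit of their integrals. By the isometry, \<open>I\<close> is determined
  up to almost sure equality and does not depend on the approximating sequence.
\<close>

definition has_ito_integral ::
  "'a measure \<Rightarrow> (real \<Rightarrow> 'a measure) \<Rightarrow> (real \<Rightarrow> 'a \<Rightarrow> real) \<Rightarrow> real \<Rightarrow>
   (real \<Rightarrow> 'a \<Rightarrow> real) \<Rightarrow> ('a \<Rightarrow> real) \<Rightarrow> bool" where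
  "has_ito_integral M F B t f I \<longleftrightarrow>
     measurable_process M t f \<and> adapted_process F t f \<and> I \<in> borel_measurable M \<and>
     (\<exists>n p \<xi>.
        (\<forall>k. elementary_data F t (n k) (p k) (\<xi> k)) \<and>
        (\<lambda>k. \<integral>\<^sup>+\<omega>. (\<integral>\<^sup>+s\<in>{0..t}.
               ennreal ((f s \<omega> - elementary_process (n k) (p k) (\<xi> k) s \<omega>)\<^sup>2) \<partial>lborel) \<partial>M)
          \<longlonglongrightarrow> 0 \<and>
        (\<lambda>k. \<integral>\<^sup>+\<omega>. ennreal ((I \<omega> - elementary_integral B (n k) (p k) (\<xi> k) \<omega>)\<^sup>2) \<partial>M)
          \<longlonglongrightarrow> 0)"

section \<open>Self-exciting multifractional processes\<close>

definition hurst_function :: "real \<Rightarrow> real \<Rightarrow> real \<Rightarrow> (real \<Rightarrow> real \<Rightarrow> real) \<Rightarrow> bool" where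
  "hurst_function T h_lo h_up h \<longleftrightarrow>
     h_lo \<le> h_up \<and> {h_lo..h_up} \<subseteq> {0<..<1} \<and>
     (\<forall>t\<in>{0..T}. \<forall>x. h t x \<in> {h_lo..h_up}) \<and>
     (\<exists>C>0. (\<forall>t\<in>{0..T}. \<forall>x y. \<bar>h t x - h t y\<bar> \<le> C * \<bar>x - y\<bar>) \<and>
            (\<forall>t\<in>{0..T}. \<forall>t'\<in>{0..T}. \<forall>x. \<bar>h t x - h t' x\<bar> \<le> C * \<bar>t - t'\<bar>))"

text \<open>
  The equation \<open>X\<^sub>t = g\<^sub>t + \<integral>\<^sub>0\<^sup>t (t - s)\<^bsup>h(t, X\<^sub>s) - 1/2\<^esup> dB\<^sub>s\<close> holds almost surely for each fixed \<open>t\<close>,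
  since the integral, whose integrand depends on \<open>t\<close>, is only defined up to a null set depending
  on \<open>t\<close>. The equation therefore determines \<open>X\<close> only up to modification. The value of the
  integrand at \<open>s = t\<close> is irrelevant.
\<close>

definition sem_process ::
  "'a measure \<Rightarrow> (real \<Rightarrow> 'a measure) \<Rightarrow> real \<Rightarrow> (real \<Rightarrow> 'a \<Rightarrow> real) \<Rightarrow> (real \<Rightarrow> real \<Rightarrow> real) \<Rightarrow>
   (real \<Rightarrow> 'a \<Rightarrow> real) \<Rightarrow> (real \<Rightarrow> 'a \<Rightarrow> real) \<Rightarrow> bool" where
  "sem_process M F T B h g X \<longleftrightarrow>
     measurable_process M T X \<and> adapted_process F T X \<and>
     (\<forall>t\<in>{0..T}. has_ito_integral M F B t
        (\<lambda>s \<omega>. (t - s) powr (h t (X s \<omega>) - 1/2)) (\<lambda>\<omega>. X t \<omega> - g t \<omega>))"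

end

theory Submission
  imports Defs
begin

text \<open>
  The self-exciting feature of the equation is the random exponent \<open>h(t, X\<^sub>s)\<close>. It is tamed path by
  path: the kernel \<open>(t - s)\<^bsup>h(t, X\<^sub>s) - 1/2\<^esup>\<close> changes little when \<open>t\<close> changes, uniformly in the values
  \<open>X\<^sub>s\<close>.

  Extend the kernel of the integral at time \<open>t\<close> by zero beyond \<open>t\<close>. Then \<open>(X\<^sub>t - g\<^sub>t) - (X\<^sub>s - g\<^sub>s)\<close> is the
  integral of the difference \<open>\<phi>\<close> of two kernels. Since \<open>h\<close> takes values in \<open>[h\<^sub>*, h\<^sup>*]\<close> and is Lipschitz
  in time, \<open>\<integral> \<phi>\<^sub>r\<^sup>2 dr \<le> Q = K |t - s|\<^bsup>2\<gamma>\<^esup>\<close> with a deterministic \<open>K\<close>, for every \<open>\<gamma> < h\<^sub>*\<close> close to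
  \<open>h\<^sub>*\<close> (\<open>kernel_difference_integral_bound\<close>).

  A stochastic integral \<open>J\<close> whose quadratic variation is bounded by a constant \<open>Q\<close> is sub-Gaussian.
  For elementary integrands, \<open>exp (\<lambda>J - \<lambda>\<^sup>2/2 \<integral> \<phi>\<^sup>2)\<close> has expectation one; along an almost surely
  convergent subsequence, Fatou's lemma gives \<open>E exp (\<lambda>J) \<le> exp (3/2 \<lambda>\<^sup>2 Q)\<close>
  (\<open>exp_moment_ito_diff\<close>), hence \<open>E |J|\<^sup>p \<le> C\<^sub>p Q\<^bsup>p/2\<^esup>\<close> (\<open>moment_ito_diff\<close>). This exponential bound
  does the work of a Burkholder-Davis-Gundy inequality. It involves one integral for \<open>t\<close> and one for \<open>s\<close>,
  each approximated along its own partitions, so elementary processes are first refined to a common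
  grid.

  With the assumption on \<open>g\<close>, \<open>E |X\<^sub>t - X\<^sub>s|\<^sup>p \<le> C |t - s|\<^bsup>\<theta>p\<^esup>\<close> for all \<open>p\<close> and all \<open>\<theta> < min h\<^sub>* \<delta>\<close>
  (\<open>sem_increment_moment\<close>), and the Kolmogorov argument yields the regular version
  (\<open>kolmogorov_holder_modification\<close>). This version is the limit of \<open>X\<close> along dyadic times
  increasing to \<open>t\<close>: it only looks into the past and is thus adapted, although null sets need not
  belong to the filtration. It still solves the equation, because replacing \<open>X\<^sub>s\<close> on a null set for each
  \<open>s\<close> changes the integrand only on a null set of \<open>[0,t] \<times> \<Omega>\<close> (\<open>sem_process_modification\<close>). Where \<open>X\<close>
  has a continuous path, the dyadic limit is \<open>X\<close> itself.
\<close>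

section \<open>Increments of the fractional kernel\<close>

lemma powr_le_max_times_powr:
  fixes z T e a :: real
  assumes "0 < z" "z \<le> T" "e \<le> a" "a \<le> e + 1"
  shows "z powr a \<le> max 1 T * z powr e"
proof -
  have "z powr (a - e) \<le> max 1 T"
  proof (cases "z \<le> 1")
    case True
    then show ?thesis using assms powr_le1[of "a - e" z] by auto
  next
    case False
    then have "z powr (a - e) \<le> z powr 1"
      using assms by (intro powr_mono) auto
    then show ?thesis using assms by auto
  qed
  then have "z powr (a - e) * z powr e \<le> max 1 T * z powr e"
    by (rule mult_right_mono) auto
  then show ?thesis by (simp add: powr_add[symmetric])
qed

lemma abs_exp_diff_le:
  fixes x y :: real
  shows "\<bar>exp x - exp y\<bar> \<le> \<bar>x - y\<bar> * max (exp x) (exp y)"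
proof -
  have *: "exp x - exp y \<le> \<bar>x - y\<bar> * max (exp x) (exp y)" if "y \<le> x" for x y :: real
  proof -
    have "exp x * (1 + (y - x)) \<le> exp x * exp (y - x)"
      by (intro mult_left_mono) auto
    also have "\<dots> = exp y" by (simp add: exp_add[symmetric])
    finally have "exp x - exp y \<le> (x - y) * exp x" by (simp add: algebra_simps)
    then show ?thesis using that by (simp add: max_def)
  qed
  show ?thesis
    using *[of x y] *[of y x] by (cases "y \<le> x") (auto simp: abs_minus_commute max.commute)
qed

text \<open>
  The kernel as a function of time \<open>t\<close> moves both in its base, from \<open>u\<close> to \<open>u + d\<close>, and in its
  exponent, from \<open>b\<close> to \<open>a\<close>. Writing both powers as exponentials, the two changes add up to
  \<open>a ln (u + d) - b ln u\<close>, which is of order \<open>d / u\<close>. For \<open>d \<le> u\<close> this gives the gain \<open>(d / u)\<^bsup>\<gamma>\<^esup>\<close>; for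
  \<open>u < d\<close> the size of the two powers alone is small enough. The role of \<open>e \<le> \<gamma>\<close> is to make
  \<open>u\<^bsup>e - \<gamma>\<^esup>\<close> decreasing in \<open>u\<close>.
\<close>

lemma kernel_increment_bound:
  fixes u d T a b e \<gamma> C :: real
  assumes u: "0 < u" and d: "0 < d" and T: "u + d \<le> T"
    and a: "a \<in> {e..e + 1}" "\<bar>a\<bar> \<le> 1" and b: "b \<in> {e..e + 1}"
    and ab: "\<bar>a - b\<bar> \<le> C * d" and C: "0 \<le> C"
    and \<gamma>: "0 \<le> \<gamma>" "\<gamma> \<le> 1" "e \<le> \<gamma>"
  shows "\<bar>(u + d) powr a - u powr b\<bar>
    \<le> 2 * max 1 T * (1 + C * (max 1 T)\<^sup>2) * d powr \<gamma> * u powr (e - \<gamma>)"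
proof -
  define m where "m = max 1 T"
  have m: "1 \<le> m" "u \<le> m" using u d T by (auto simp: m_def)
  define G where "G = 2 * m * max u d powr \<gamma> * u powr (e - \<gamma>)"
  have G0: "0 \<le> G" using m by (auto simp: G_def)
  have ud: "(u + d) powr a \<le> G"
  proof -
    have "(u + d) powr a \<le> m * (u + d) powr e"
      unfolding m_def using assms by (intro powr_le_max_times_powr) auto
    also have "(u + d) powr e = (u + d) powr \<gamma> * (u + d) powr (e - \<gamma>)"
      by (simp add: powr_add[symmetric])
    also have "\<dots> \<le> (2 * max u d powr \<gamma>) * u powr (e - \<gamma>)"
    proof (intro mult_mono)
      have "(u + d) powr \<gamma> \<le> (2 * max u d) powr \<gamma>"
        using u d \<gamma> by (intro powr_mono2) auto
      also have "\<dots> = 2 powr \<gamma> * max u d powr \<gamma>"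
        using u d by (subst powr_mult) auto
      also have "\<dots> \<le> 2 powr 1 * max u d powr \<gamma>"
        using \<gamma> by (intro mult_right_mono powr_mono) auto
      finally show "(u + d) powr \<gamma> \<le> 2 * max u d powr \<gamma>" by simp
      show "(u + d) powr (e - \<gamma>) \<le> u powr (e - \<gamma>)"
        using u d \<gamma> by (intro powr_mono2') auto
    qed auto
    finally show ?thesis using m by (simp add: G_def algebra_simps mult_left_mono)
  qed
  have ub: "u powr b \<le> G"
  proof -
    have "u powr b \<le> m * u powr e"
      unfolding m_def using assms by (intro powr_le_max_times_powr) auto
    also have "u powr e = u powr \<gamma> * u powr (e - \<gamma>)"
      by (simp add: powr_add[symmetric])
    also have "m * (u powr \<gamma> * u powr (e - \<gamma>)) \<le> (2 * m) * (max u d powr \<gamma> * u powr (e - \<gamma>))"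
      using u d \<gamma> m by (intro mult_mono[OF _ mult_right_mono] powr_mono2) auto
    finally show ?thesis by (simp add: G_def algebra_simps)
  qed
  have Cm: "0 \<le> C * m\<^sup>2" using C by auto
  show ?thesis
  proof (cases "u < d")
    case True
    have "\<bar>(u + d) powr a - u powr b\<bar> \<le> G"
      using ud ub u d by (smt (verit) powr_ge_zero)
    also have "\<dots> = 2 * m * 1 * d powr \<gamma> * u powr (e - \<gamma>)"
      using True by (simp add: G_def max_def)
    also have "\<dots> \<le> 2 * m * (1 + C * m\<^sup>2) * d powr \<gamma> * u powr (e - \<gamma>)"
      using m Cm by (intro mult_mono) auto
    finally show ?thesis by (simp add: m_def)
  next
    case False
    \<comment> \<open>Here \<open>d / u \<le> 1\<close>, which allows the exponent of \<open>d / u\<close> to be lowered from 1 to \<open>\<gamma>\<close>.\<close>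
    define x where "x = a * ln (u + d)"
    define y where "y = b * ln u"
    have xy: "(u + d) powr a = exp x" "u powr b = exp y"
      using u d by (auto simp: x_def y_def powr_def)
    have lnu: "\<bar>ln u\<bar> \<le> m\<^sup>2 / u"
    proof (cases "u \<le> 1")
      case True
      have "- ln u = ln (1 / u)" using u by (simp add: ln_div)
      also have "\<dots> \<le> 1 / u" using ln_le_minus_one[of "1 / u"] u by simp
      also have "\<dots> \<le> m\<^sup>2 / u" using u m by (intro divide_right_mono) auto
      finally show ?thesis using True u by simp
    next
      case False
      have "ln u \<le> u" using ln_le_minus_one[of u] u by simp
      also have "\<dots> \<le> m\<^sup>2 / u" using u m by (simp add: field_simps power2_eq_square mult_mono)
      finally show ?thesis using False u by simp
    qed
    have lnd: "\<bar>ln (u + d) - ln u\<bar> \<le> d / u"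
    proof -
      have "u + d = u * (1 + d / u)" using u by (simp add: field_simps)
      moreover have "0 < 1 + d / u" using u d by (intro add_pos_pos) auto
      ultimately have "ln (u + d) - ln u = ln (1 + d / u)"
        using u by (simp add: ln_mult)
      also have "\<dots> \<le> d / u" using u d by (intro ln_add_one_self_le_self) auto
      finally show ?thesis using u d by simp
    qed
    have "x - y = a * (ln (u + d) - ln u) + (a - b) * ln u"
      by (simp add: x_def y_def algebra_simps)
    also have "\<bar>\<dots>\<bar> \<le> \<bar>a\<bar> * \<bar>ln (u + d) - ln u\<bar> + \<bar>a - b\<bar> * \<bar>ln u\<bar>"
      by (metis abs_mult abs_triangle_ineq)
    also have "\<dots> \<le> 1 * (d / u) + (C * d) * (m\<^sup>2 / u)"
      using a ab lnu lnd u d C by (intro add_mono mult_mono) auto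
    also have "\<dots> = (1 + C * m\<^sup>2) * (d / u)" by (simp add: algebra_simps)
    also have "\<dots> \<le> (1 + C * m\<^sup>2) * (d / u) powr \<gamma>"
    proof (intro mult_left_mono)
      show "d / u \<le> (d / u) powr \<gamma>"
        using powr_mono'[of \<gamma> 1 "d / u"] u d False \<gamma> by auto
    qed (use Cm in auto)
    finally have xy_le: "\<bar>x - y\<bar> \<le> (1 + C * m\<^sup>2) * (d / u) powr \<gamma>" .
    have "\<bar>(u + d) powr a - u powr b\<bar> \<le> \<bar>x - y\<bar> * max (exp x) (exp y)"
      unfolding xy by (rule abs_exp_diff_le)
    also have "\<dots> \<le> ((1 + C * m\<^sup>2) * (d / u) powr \<gamma>) * G"
      using xy_le ud ub Cm by (intro mult_mono) (auto simp: xy le_max_iff_disj)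
    also have "\<dots> = 2 * m * (1 + C * m\<^sup>2) * ((d / u) powr \<gamma> * u powr \<gamma>) * u powr (e - \<gamma>)"
      using False by (simp add: G_def max_def algebra_simps)
    also have "(d / u) powr \<gamma> * u powr \<gamma> = d powr \<gamma>"
      using u d by (simp add: powr_mult[symmetric])
    finally show ?thesis by (simp add: m_def)
  qed
qed

text \<open>
  On the part of the time interval where only the later kernel is alive, the smallness comes from
  the length of that part. The right-hand side has the form of \<open>kernel_increment_bound\<close>, so that one
  integration serves both.
\<close>

lemma kernel_tail_bound:
  fixes u d T a e \<gamma> :: real
  assumes "0 < u" "u \<le> d" "d \<le> T" "a \<in> {e..e + 1}" "0 \<le> \<gamma>"
  shows "u powr a \<le> max 1 T * d powr \<gamma> * u powr (e - \<gamma>)"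
proof -
  have "u powr a \<le> max 1 T * u powr e"
    using assms by (intro powr_le_max_times_powr) auto
  also have "u powr e = u powr \<gamma> * u powr (e - \<gamma>)"
    by (simp add: powr_add[symmetric])
  also have "max 1 T * \<dots> \<le> max 1 T * (d powr \<gamma> * u powr (e - \<gamma>))"
    using assms by (intro mult_left_mono mult_right_mono powr_mono2) auto
  finally show ?thesis by (simp add: mult.assoc)
qed

lemma nn_integral_reflected_powr:
  fixes t b :: real
  assumes "0 \<le> t" "-1 < b"
  shows "(\<integral>\<^sup>+r. ennreal (indicator {0..t} r * (t - r) powr b) \<partial>lborel) = ennreal (t powr (b + 1) / (b + 1))"
proof -
  have "(\<integral>\<^sup>+r. ennreal (indicator {0..t} r * (t - r) powr b) \<partial>lborel)
      = (\<integral>\<^sup>+r. ennreal (indicator {0..t} (t - r) * r powr b) \<partial>lborel)"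
    by (subst nn_integral_real_affine[where c = "-1" and t = t]) auto
  also have "\<dots> = (\<integral>\<^sup>+r. ennreal (indicator {0..t} r * r powr b) \<partial>lborel)"
    by (intro nn_integral_cong) (auto simp: indicator_def)
  also have "\<dots> = (\<integral>\<^sup>+r. ennreal (r powr b) * indicator {0..t} r \<partial>lborel)"
    by (intro nn_integral_cong) (auto simp: indicator_def)
  also have "\<dots> = ennreal (t powr (b + 1) / (b + 1))"
    using assms by (intro nn_integral_has_integral_lebesgue' has_integral_powr_from_0) auto
  finally show ?thesis .
qed


text \<open>
  Near \<open>r = s\<close> and \<open>r = t\<close> the squared difference is at most a multiple of
  \<open>|t - s|\<^bsup>2\<gamma>\<^esup> u\<^bsup>2(lo - 1/2 - \<gamma>)\<^esup>\<close>, \<open>u\<close> being the distance to the singularity, and this is integrable exactly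
  for \<open>\<gamma> < lo\<close>. That one constant serves all paths \<open>x\<close> is what makes the quadratic variation of the
  increments of the stochastic integral deterministically bounded.
\<close>

lemma kernel_difference_integral_bound:
  assumes T: "0 < T" and h: "hurst_function T lo up h"
    and \<gamma>: "0 < \<gamma>" "lo - 1 / 2 \<le> \<gamma>" "\<gamma> < lo"
  obtains K where "0 < K"
    "\<And>s t x. 0 \<le> s \<Longrightarrow> s < t \<Longrightarrow> t \<le> T \<Longrightarrow>
      (\<integral>\<^sup>+r. ennreal ((indicator {0..t} r * (t - r) powr (h t (x r) - 1 / 2)
        - indicator {0..s} r * (s - r) powr (h s (x r) - 1 / 2))\<^sup>2) \<partial>lborel)
      \<le> ennreal (K * (t - s) powr (2 * \<gamma>))"
proof -
  have lo: "0 < lo" "lo < 1" "up < 1"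
    using h by (auto simp: hurst_function_def)
  have range: "h t x \<in> {lo..up}" if "t \<in> {0..T}" for t x
    using h that by (auto simp: hurst_function_def)
  obtain C where C: "0 < C" "\<And>t t' x. t \<in> {0..T} \<Longrightarrow> t' \<in> {0..T} \<Longrightarrow> \<bar>h t x - h t' x\<bar> \<le> C * \<bar>t - t'\<bar>"
    using h unfolding hurst_function_def by blast
  define e where "e = lo - 1 / 2"
  define \<beta> where "\<beta> = 2 * (e - \<gamma>)"
  have \<beta>: "-1 < \<beta>" using \<gamma> by (simp add: \<beta>_def e_def)
  define L where "L = 2 * max 1 T * (1 + C * (max 1 T)\<^sup>2)"
  have L: "max 1 T \<le> L" "0 < L"
  proof -
    have "max 1 T * 1 \<le> (2 * max 1 T) * (1 + C * (max 1 T)\<^sup>2)"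
      using C by (intro mult_mono) auto
    then show "max 1 T \<le> L" by (simp add: L_def)
    then show "0 < L" by linarith
  qed
  define K where "K = L\<^sup>2 * (2 * (T powr (\<beta> + 1) / (\<beta> + 1)))"
  have K: "0 < K" using L T \<beta> by (simp add: K_def)
  have exponent: "h t x - 1 / 2 \<in> {e..e + 1}" "\<bar>h t x - 1 / 2\<bar> \<le> 1" if "t \<in> {0..T}" for t x
    using range[OF that, of x] lo by (auto simp: e_def)
  show thesis
  proof (rule that[OF K])
    fix s t :: real and x :: "real \<Rightarrow> real"
    assume st: "0 \<le> s" "s < t" "t \<le> T"
    then have sT: "s \<in> {0..T}" and tT: "t \<in> {0..T}" by auto
    define d where "d = t - s"
    have d: "0 < d" "d \<le> T" using st by (auto simp: d_def)
    define D where "D r = indicator {0..t} r * (t - r) powr (h t (x r) - 1 / 2)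
        - indicator {0..s} r * (s - r) powr (h s (x r) - 1 / 2)" for r
    have square: "y\<^sup>2 \<le> L\<^sup>2 * d powr (2 * \<gamma>) * u powr \<beta>" if "\<bar>y\<bar> \<le> L * d powr \<gamma> * u powr (e - \<gamma>)" for y u
    proof -
      have "\<bar>y\<bar>\<^sup>2 \<le> (L * d powr \<gamma> * u powr (e - \<gamma>))\<^sup>2"
        using that by (intro power_mono) auto
      also have "\<dots> = L\<^sup>2 * d powr (2 * \<gamma>) * u powr \<beta>"
      proof -
        have "(z powr c)\<^sup>2 = z powr (2 * c)" for z c :: real
          by (simp add: power2_eq_square powr_add[symmetric])
        then show ?thesis by (simp only: power_mult_distrib \<beta>_def)
      qed
      finally show ?thesis by simp
    qed
    have D_le: "(D r)\<^sup>2 \<le> L\<^sup>2 * d powr (2 * \<gamma>) * (indicator {0..s} r * (s - r) powr \<beta> + indicator {0..t} r * (t - r) powr \<beta>)" for r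
    proof -
      \<comment> \<open>At \<open>r = t\<close>, and for the earlier kernel at \<open>r = s\<close>, the kernel is \<open>0 powr _ = 0\<close>.\<close>
      consider "r \<notin> {0..t} \<or> r = t" | "0 \<le> r" "r < s" | "s \<le> r" "r < t" by fastforce
      then show ?thesis
      proof cases
        case 1
        then have "D r = 0" using st by (auto simp: D_def)
        then show ?thesis by simp
      next
        case 2
        then have D: "D r = ((s - r) + d) powr (h t (x r) - 1 / 2) - (s - r) powr (h s (x r) - 1 / 2)"
          using st by (simp add: D_def d_def)
        have "\<bar>D r\<bar> \<le> L * d powr \<gamma> * (s - r) powr (e - \<gamma>)"
          unfolding D L_def
        proof (rule kernel_increment_bound)
          show "\<bar>h t (x r) - 1 / 2 - (h s (x r) - 1 / 2)\<bar> \<le> C * d"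
            using C(2)[OF tT sT, of "x r"] st by (simp add: d_def)
        qed (use 2 d st exponent[OF tT] exponent[OF sT] C \<gamma> lo in \<open>auto simp: d_def e_def\<close>)
        then have "(D r)\<^sup>2 \<le> L\<^sup>2 * d powr (2 * \<gamma>) * (s - r) powr \<beta>"
          by (rule square)
        also have "\<dots> \<le> L\<^sup>2 * d powr (2 * \<gamma>) * (indicator {0..s} r * (s - r) powr \<beta> + indicator {0..t} r * (t - r) powr \<beta>)"
          using 2 by (intro mult_left_mono) auto
        finally show ?thesis .
      next
        case 3
        then have D: "D r = (t - r) powr (h t (x r) - 1 / 2)"
          using st by (auto simp: D_def indicator_def)
        have "\<bar>D r\<bar> \<le> max 1 T * d powr \<gamma> * (t - r) powr (e - \<gamma>)"
          unfolding D using kernel_tail_bound[of "t - r" d T "h t (x r) - 1 / 2" e \<gamma>] 3 d exponent[OF tT] \<gamma>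
          by (simp add: d_def)
        also have "\<dots> \<le> L * d powr \<gamma> * (t - r) powr (e - \<gamma>)"
          using L by (intro mult_right_mono) auto
        finally have "(D r)\<^sup>2 \<le> L\<^sup>2 * d powr (2 * \<gamma>) * (t - r) powr \<beta>"
          by (rule square)
        also have "\<dots> \<le> L\<^sup>2 * d powr (2 * \<gamma>) * (indicator {0..s} r * (s - r) powr \<beta> + indicator {0..t} r * (t - r) powr \<beta>)"
          using 3 st by (intro mult_left_mono) auto
        finally show ?thesis .
      qed
    qed
    have "(\<integral>\<^sup>+r. ennreal ((D r)\<^sup>2) \<partial>lborel)
        \<le> (\<integral>\<^sup>+r. ennreal (L\<^sup>2 * d powr (2 * \<gamma>)) * (ennreal (indicator {0..s} r * (s - r) powr \<beta>)
            + ennreal (indicator {0..t} r * (t - r) powr \<beta>)) \<partial>lborel)"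
    proof (intro nn_integral_mono)
      fix r
      show "ennreal ((D r)\<^sup>2) \<le> ennreal (L\<^sup>2 * d powr (2 * \<gamma>)) * (ennreal (indicator {0..s} r * (s - r) powr \<beta>)
            + ennreal (indicator {0..t} r * (t - r) powr \<beta>))"
        using ennreal_leI[OF D_le[of r]]
        by (simp add: ennreal_mult[symmetric] ennreal_plus[symmetric] del: ennreal_plus)
    qed
    also have "\<dots> = ennreal (L\<^sup>2 * d powr (2 * \<gamma>)) * (ennreal (s powr (\<beta> + 1) / (\<beta> + 1)) + ennreal (t powr (\<beta> + 1) / (\<beta> + 1)))"
      using st \<beta> by (simp add: nn_integral_cmult nn_integral_add nn_integral_reflected_powr)
    also have "\<dots> \<le> ennreal (L\<^sup>2 * d powr (2 * \<gamma>)) * (ennreal (T powr (\<beta> + 1) / (\<beta> + 1)) + ennreal (T powr (\<beta> + 1) / (\<beta> + 1)))"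
      using st \<beta> by (intro mult_left_mono add_mono ennreal_leI divide_right_mono powr_mono2) auto
    also have "\<dots> = ennreal (K * d powr (2 * \<gamma>))"
      using \<beta> by (simp add: K_def ennreal_mult[symmetric] ennreal_plus[symmetric] mult_ac del: ennreal_plus)
    finally show "(\<integral>\<^sup>+r. ennreal ((indicator {0..t} r * (t - r) powr (h t (x r) - 1 / 2)
        - indicator {0..s} r * (s - r) powr (h s (x r) - 1 / 2))\<^sup>2) \<partial>lborel)
      \<le> ennreal (K * (t - s) powr (2 * \<gamma>))"
      by (simp add: D_def d_def)
  qed
qed

section \<open>Exponential martingales of elementary integrals\<close>

lemma increasing_grid_mono:
  fixes q :: "nat \<Rightarrow> real"
  assumes "\<And>j. j < N \<Longrightarrow> q j < q (Suc j)" "i \<le> j" "j \<le> N"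
  shows "q i \<le> q j"
  using assms(2,3)
proof (induction j rule: dec_induct)
  case (step k)
  then show ?case using assms(1)[of k] by simp
qed simp

locale filtered_brownian_motion = prob_space M
  for M :: "'a measure" +
  fixes F :: "real \<Rightarrow> 'a measure" and T :: real and B :: "real \<Rightarrow> 'a \<Rightarrow> real"
  assumes filtration: "filtration_on M T F"
    and brownian: "brownian_motion M F T B"
begin

lemma space_filtration: "t \<in> {0..T} \<Longrightarrow> space (F t) = space M"
  using filtration by (auto simp: filtration_on_def subalgebra_def)

lemma measurable_filtration_mono:
  assumes "f \<in> measurable (F s) N" "0 \<le> s" "s \<le> t" "t \<le> T"
  shows "f \<in> measurable (F t) N"
proof -
  have "space (F t) = space (F s)" using assms by (simp add: space_filtration)
  moreover have "sets (F s) \<subseteq> sets (F t)"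
    using filtration assms by (auto simp: filtration_on_def)
  ultimately show ?thesis using assms(1) by (auto simp: measurable_def)
qed

lemma measurable_from_filtration:
  assumes "f \<in> measurable (F t) N" "t \<in> {0..T}"
  shows "f \<in> measurable M N"
  using assms filtration by (auto simp: filtration_on_def intro: measurable_from_subalg)

lemma brownian_adapted: "t \<in> {0..T} \<Longrightarrow> B t \<in> borel_measurable (F t)"
  using brownian by (auto simp: brownian_motion_def adapted_process_def)

lemma brownian_measurable: "t \<in> {0..T} \<Longrightarrow> B t \<in> borel_measurable M"
  by (metis brownian_adapted measurable_from_filtration)

text \<open>
  Independence of \<open>F\<^sub>s\<close> and the increment, in the form that yields a product law. As \<open>indep_var\<close>
  relates random variables with values in one type, the increment may be replaced by a function
  \<open>V\<close> of it.
\<close>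

lemma indep_brownian_increment:
  assumes "0 \<le> s" "s < t" "t \<le> T" "U \<in> measurable (F s) N"
    and V: "V \<in> measurable (vimage_algebra (space M) (\<lambda>\<omega>. B t \<omega> - B s \<omega>) borel) N'"
  shows "indep_var N U N' V"
proof -
  let ?S = "vimage_algebra (space M) (\<lambda>\<omega>. B t \<omega> - B s \<omega>) borel"
  have s: "s \<in> {0..T}" and t: "t \<in> {0..T}" using assms by auto
  note [measurable] = brownian_measurable[OF s] brownian_measurable[OF t]
  have indep: "indep_set (sets (F s)) (sets ?S)"
    using brownian assms by (auto simp: brownian_motion_def)
  then have S: "subalgebra M ?S"
    by (auto simp: subalgebra_def indep_sets2_eq)
  have "indep_set (sigma_sets (space M) {U -` A \<inter> space M |A. A \<in> sets N})
     (sigma_sets (space M) {V -` A \<inter> space M |A. A \<in> sets N'})"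
    using indep unfolding indep_set_def
  proof (rule indep_sets_mono_sets)
    have "sigma_sets (space M) {U -` A \<inter> space M |A. A \<in> sets N} \<subseteq> sets (F s)"
      using sets.sigma_sets_subset[of "{U -` A \<inter> space M |A. A \<in> sets N}" "F s"]
        measurable_sets[OF assms(4)] space_filtration[OF s] by auto
    moreover have "sigma_sets (space M) {V -` A \<inter> space M |A. A \<in> sets N'} \<subseteq> sets ?S"
      using sets.sigma_sets_subset[of "{V -` A \<inter> space M |A. A \<in> sets N'}" ?S]
        measurable_sets[OF V] by auto
    ultimately show "case_bool (sigma_sets (space M) {U -` A \<inter> space M |A. A \<in> sets N})
        (sigma_sets (space M) {V -` A \<inter> space M |A. A \<in> sets N'}) i
      \<subseteq> case_bool (sets (F s)) (sets ?S) i" for i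
      by (auto split: bool.split)
  qed
  then show ?thesis
    unfolding indep_var_eq
    using measurable_from_filtration[OF assms(4) s] measurable_from_subalg[OF S V] by auto
qed

end

text \<open>
  Completing the square turns the integrand into the normal density with mean \<open>c \<sigma>\<^sup>2\<close>.
\<close>

lemma nn_integral_normal_exp:
  fixes c \<sigma> :: real
  assumes "0 < \<sigma>"
  shows "(\<integral>\<^sup>+y. ennreal (exp (c * y - c\<^sup>2 * \<sigma>\<^sup>2 / 2)) * ennreal (normal_density 0 \<sigma> y) \<partial>lborel) = 1"
proof -
  have "exp (c * y - c\<^sup>2 * \<sigma>\<^sup>2 / 2) * normal_density 0 \<sigma> y = normal_density (c * \<sigma>\<^sup>2) \<sigma> y" for y
  proof -
    have "c * y - c\<^sup>2 * \<sigma>\<^sup>2 / 2 + - y\<^sup>2 / (2 * \<sigma>\<^sup>2) = - (y - c * \<sigma>\<^sup>2)\<^sup>2 / (2 * \<sigma>\<^sup>2)"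
      using assms by (simp add: field_simps power2_eq_square)
    then show ?thesis
      unfolding normal_density_def by (simp add: exp_add[symmetric] field_simps)
  qed
  then have "(\<integral>\<^sup>+y. ennreal (exp (c * y - c\<^sup>2 * \<sigma>\<^sup>2 / 2)) * ennreal (normal_density 0 \<sigma> y) \<partial>lborel)
      = (\<integral>\<^sup>+y. ennreal (normal_density (c * \<sigma>\<^sup>2) \<sigma> y) \<partial>lborel)"
    by (simp add: ennreal_mult'[symmetric])
  also have "\<dots> = 1"
    using assms by (subst nn_integral_eq_integral) auto
  finally show ?thesis .
qed

context filtered_brownian_motion
begin

text \<open>
  Conditionally on \<open>F\<^sub>s\<close>, the coefficient \<open>c\<close> is a constant and the increment is centred Gaussian with
  variance \<open>t - s\<close>, so the last factor integrates to one. The conditioning is carried out by Tonelli's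
  theorem for the product law of \<open>(Z, c)\<close> and the increment.
\<close>

lemma exp_increment_step:
  assumes st: "0 \<le> s" "s < t" "t \<le> T"
    and Z: "Z \<in> borel_measurable (F s)" and c: "c \<in> borel_measurable (F s)"
  shows "(\<integral>\<^sup>+\<omega>. ennreal (exp (Z \<omega> + (c \<omega> * (B t \<omega> - B s \<omega>) - 1 / 2 * (c \<omega>)\<^sup>2 * (t - s)))) \<partial>M)
    = (\<integral>\<^sup>+\<omega>. ennreal (exp (Z \<omega>)) \<partial>M)"
proof -
  define \<Delta> where "\<Delta> = (\<lambda>\<omega>. B t \<omega> - B s \<omega>)"
  define U where "U = (\<lambda>\<omega>. (Z \<omega>, c \<omega>))"
  have U: "U \<in> measurable (F s) (borel \<Otimes>\<^sub>M borel)"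
    unfolding U_def using Z c by measurable
  \<comment> \<open>The first component of \<open>V\<close> only pads it to the type of \<open>U\<close>.\<close>
  define V where "V = (\<lambda>\<omega>. (0 :: real, \<Delta> \<omega>))"
  let ?R = "borel \<Otimes>\<^sub>M borel :: (real \<times> real) measure"
  have "\<Delta> \<in> borel_measurable (vimage_algebra (space M) \<Delta> borel)"
    by (rule measurable_vimage_algebra1) simp
  then have V: "V \<in> measurable (vimage_algebra (space M) \<Delta> borel) ?R"
    unfolding V_def by measurable
  have ind: "indep_var ?R U ?R V"
    using V unfolding \<Delta>_def by (rule indep_brownian_increment[OF st U])
  then have [measurable]: "random_variable ?R U" "random_variable ?R V"
    and pair: "distr M ?R U \<Otimes>\<^sub>M distr M ?R V = distr M (?R \<Otimes>\<^sub>M ?R) (\<lambda>\<omega>. (U \<omega>, V \<omega>))"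
    unfolding indep_var_distribution_eq by auto
  have dist: "distributed M lborel \<Delta> (\<lambda>x. ennreal (normal_density 0 (sqrt (t - s)) x))"
    using brownian st unfolding brownian_motion_def \<Delta>_def by auto
  interpret D: prob_space "distr M ?R V" by (rule prob_space_distr) simp
  define f :: "(real \<times> real) \<times> (real \<times> real) \<Rightarrow> ennreal" where
    "f = (\<lambda>x. ennreal (exp (fst (fst x) + (snd (fst x) * snd (snd x) - 1 / 2 * (snd (fst x))\<^sup>2 * (t - s)))))"
  have [measurable]: "f \<in> borel_measurable (?R \<Otimes>\<^sub>M ?R)"
    unfolding f_def by measurable
  have inner: "(\<integral>\<^sup>+v. f (u, v) \<partial>distr M ?R V) = ennreal (exp (fst u))" for u :: "real \<times> real"
  proof -
    obtain z a where u: "u = (z, a)" by (cases u)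
    have [measurable]: "(\<lambda>v. f ((z, a), v)) \<in> borel_measurable ?R"
      unfolding f_def fst_conv snd_conv by measurable
    have "(\<integral>\<^sup>+v. f (u, v) \<partial>distr M ?R V) = (\<integral>\<^sup>+\<omega>. f ((z, a), V \<omega>) \<partial>M)"
      unfolding u by (rule nn_integral_distr) auto
    also have "\<dots> = (\<integral>\<^sup>+\<omega>. ennreal (exp (z + (a * \<Delta> \<omega> - 1 / 2 * a\<^sup>2 * (t - s)))) \<partial>M)"
      by (simp add: f_def V_def)
    also have "\<dots> = (\<integral>\<^sup>+y. ennreal (normal_density 0 (sqrt (t - s)) y)
        * ennreal (exp (z + (a * y - 1 / 2 * a\<^sup>2 * (t - s)))) \<partial>lborel)"
      by (rule distributed_nn_integral[OF dist, symmetric]) simp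
    also have "\<dots> = (\<integral>\<^sup>+y. ennreal (exp z) * (ennreal (exp (a * y - a\<^sup>2 * (sqrt (t - s))\<^sup>2 / 2))
        * ennreal (normal_density 0 (sqrt (t - s)) y)) \<partial>lborel)"
      using st by (intro nn_integral_cong) (simp add: exp_add ennreal_mult mult_ac)
    also have "\<dots> = ennreal (exp z)"
      using nn_integral_normal_exp[of "sqrt (t - s)" a] st
      by (subst nn_integral_cmult) auto
    finally show ?thesis by (simp add: u)
  qed
  have "(\<integral>\<^sup>+\<omega>. ennreal (exp (Z \<omega> + (c \<omega> * (B t \<omega> - B s \<omega>) - 1 / 2 * (c \<omega>)\<^sup>2 * (t - s)))) \<partial>M)
      = (\<integral>\<^sup>+\<omega>. f (U \<omega>, V \<omega>) \<partial>M)"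
    by (simp add: f_def U_def V_def \<Delta>_def)
  also have "\<dots> = (\<integral>\<^sup>+x. f x \<partial>distr M (?R \<Otimes>\<^sub>M ?R) (\<lambda>\<omega>. (U \<omega>, V \<omega>)))"
    by (subst nn_integral_distr) auto
  also have "\<dots> = (\<integral>\<^sup>+u. \<integral>\<^sup>+v. f (u, v) \<partial>distr M ?R V \<partial>distr M ?R U)"
    unfolding pair[symmetric]
    by (rule D.nn_integral_fst[symmetric])
      (simp cong: measurable_cong_sets sets_pair_measure_cong)
  also have "\<dots> = (\<integral>\<^sup>+u. ennreal (exp (fst u)) \<partial>distr M ?R U)"
    by (simp add: inner)
  also have "\<dots> = (\<integral>\<^sup>+\<omega>. ennreal (exp (fst (U \<omega>))) \<partial>M)"
    by (rule nn_integral_distr) auto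
  finally show ?thesis by (simp add: U_def)
qed

lemma exp_martingale_grid:
  assumes "\<And>j. j < N \<Longrightarrow> q j < q (Suc j)" "0 \<le> q 0" "q N \<le> T"
    and "\<And>j. j < N \<Longrightarrow> c j \<in> borel_measurable (F (q j))"
  shows "(\<integral>\<^sup>+\<omega>. ennreal (exp (\<Sum>j<N. c j \<omega> * (B (q (Suc j)) \<omega> - B (q j) \<omega>)
             - 1 / 2 * (c j \<omega>)\<^sup>2 * (q (Suc j) - q j))) \<partial>M) = 1"
  using assms
proof (induction N)
  case 0
  then show ?case by (simp add: emeasure_space_1)
next
  case (Suc N)
  have mono: "q i \<le> q j" if "i \<le> j" "j \<le> Suc N" for i j
    using increasing_grid_mono[of "Suc N" q] Suc.prems(1) that by blast
  have qN: "q N < q (Suc N)" using Suc.prems by simp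
  have q: "q j \<in> {0..T}" if "j \<le> Suc N" for j
    using mono[of 0 j] mono[of j "Suc N"] that Suc.prems by auto
  define Z where "Z \<omega> = (\<Sum>j<N. c j \<omega> * (B (q (Suc j)) \<omega> - B (q j) \<omega>)
             - 1 / 2 * (c j \<omega>)\<^sup>2 * (q (Suc j) - q j))" for \<omega>
  have lift: "f \<in> borel_measurable (F (q N))" if "f \<in> borel_measurable (F (q j))" "j \<le> N"
    for f :: "'a \<Rightarrow> real" and j
    using measurable_filtration_mono[OF that(1)] mono[of j N] q[of j] q[of N] that(2) by auto
  have "Z \<in> borel_measurable (F (q N))"
    unfolding Z_def
    by (intro borel_measurable_sum borel_measurable_diff borel_measurable_times
        borel_measurable_const borel_measurable_power)
      (auto intro!: lift[OF Suc.prems(4)] lift[OF brownian_adapted] q)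
  then have "(\<integral>\<^sup>+\<omega>. ennreal (exp (Z \<omega> + (c N \<omega> * (B (q (Suc N)) \<omega> - B (q N) \<omega>)
       - 1 / 2 * (c N \<omega>)\<^sup>2 * (q (Suc N) - q N)))) \<partial>M) = (\<integral>\<^sup>+\<omega>. ennreal (exp (Z \<omega>)) \<partial>M)"
    using q[of N] q[of "Suc N"] qN Suc.prems(4)[of N] by (intro exp_increment_step) auto
  also have "\<dots> = 1"
    unfolding Z_def using Suc.prems q[of N] by (intro Suc.IH) auto
  finally show ?case by (simp add: Z_def)
qed

end

text \<open>
  The last property says that no point of \<open>P\<close> lies strictly inside a cell of the grid. All later
  arguments about refinement use the grid only through this property.
\<close>

lemma sorted_grid_exists:
  fixes P :: "real set"
  assumes "finite P" "P \<noteq> {}"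
  obtains N q where "\<And>j. j < N \<Longrightarrow> q j < q (Suc j)" "q 0 = Min P" "q N = Max P"
    "\<And>x j. x \<in> P \<Longrightarrow> j < N \<Longrightarrow> x \<le> q j \<or> q (Suc j) \<le> x"
proof -
  define l where "l = sorted_list_of_set P"
  define N where "N = length l - 1"
  have l: "set l = P" "sorted_wrt (<) l" "l \<noteq> []"
    using assms by (auto simp: l_def)
  have len: "length l = Suc N" using l(3) by (simp add: N_def)
  have less: "l ! i < l ! j" if "i < j" "j \<le> N" for i j
    using sorted_wrt_nth_less[OF l(2)] that len by simp
  have le: "l ! i \<le> l ! j" if "i \<le> j" "j \<le> N" for i j
    using less[of i j] that by (cases "i = j") auto
  have mem: "\<exists>k\<le>N. x = l ! k" if "x \<in> P" for x
    using that l(1) len by (metis in_set_conv_nth less_Suc_eq_le)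
  have inP: "l ! k \<in> P" if "k \<le> N" for k
    using that l(1) len by (metis nth_mem less_Suc_eq_le)
  show thesis
  proof (rule that[of N "\<lambda>j. l ! j"])
    show "l ! j < l ! Suc j" if "j < N" for j using less that by simp
    show "l ! 0 = Min P"
      using assms mem le inP by (intro Min_eqI[symmetric]) fastforce+
    show "l ! N = Max P"
      using assms mem le inP by (intro Max_eqI[symmetric]) fastforce+
    show "x \<le> l ! j \<or> l ! Suc j \<le> x" if x: "x \<in> P" and j: "j < N" for x j
    proof -
      obtain k where "k \<le> N" "x = l ! k" using mem[OF x] by blast
      then show ?thesis using le[of k j] le[of "Suc j" k] j by (cases "k \<le> j") auto
    qed
  qed
qed

lemma elementary_process_grid_const:
  assumes G: "\<And>i. i \<le> n \<Longrightarrow> p i \<le> a \<or> b \<le> p i" and s: "s \<in> {a<..b}"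
  shows "elementary_process n p \<xi> s \<omega> = elementary_process n p \<xi> b \<omega>"
  unfolding elementary_process_def
proof (intro sum.cong refl)
  fix i assume "i \<in> {..<n}"
  then have "p i \<le> a \<or> b \<le> p i" "p (Suc i) \<le> a \<or> b \<le> p (Suc i)" using G by auto
  then show "\<xi> i \<omega> * indicator {p i<..p (Suc i)} s = \<xi> i \<omega> * indicator {p i<..p (Suc i)} b"
    using s by (auto simp: indicator_def)
qed

text \<open>
  Because no \<open>p i\<close> lies inside a cell, the increments of \<open>B\<close> over the cells to the left of a
  partition point \<open>y\<close> are the increments of \<open>B\<close> stopped at \<open>y\<close>, whose sum telescopes.
\<close>

lemma elementary_integral_refine:
  assumes q: "\<And>j. j < N \<Longrightarrow> q j < q (Suc j)"
    and G: "\<And>i j. i \<le> n \<Longrightarrow> j < N \<Longrightarrow> p i \<le> q j \<or> q (Suc j) \<le> p i"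
    and range: "\<And>i. i \<le> n \<Longrightarrow> q 0 \<le> p i \<and> p i \<le> q N"
    and p: "\<And>i. i < n \<Longrightarrow> p i < p (Suc i)"
  shows "(\<Sum>j<N. elementary_process n p \<xi> (q (Suc j)) \<omega> * (B (q (Suc j)) \<omega> - B (q j) \<omega>))
    = elementary_integral B n p \<xi> \<omega>"
proof -
  have below: "(\<Sum>j<N. indicator {..y} (q (Suc j)) * (B (q (Suc j)) \<omega> - B (q j) \<omega>)) = B y \<omega> - B (q 0) \<omega>"
    if y: "q 0 \<le> y" "y \<le> q N" "\<And>j. j < N \<Longrightarrow> y \<le> q j \<or> q (Suc j) \<le> y" for y
  proof -
    have "(\<Sum>j<N. indicator {..y} (q (Suc j)) * (B (q (Suc j)) \<omega> - B (q j) \<omega>))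
        = (\<Sum>j<N. B (min y (q (Suc j))) \<omega> - B (min y (q j)) \<omega>)"
    proof (intro sum.cong refl)
      fix j assume "j \<in> {..<N}"
      then show "indicator {..y} (q (Suc j)) * (B (q (Suc j)) \<omega> - B (q j) \<omega>)
        = B (min y (q (Suc j))) \<omega> - B (min y (q j)) \<omega>"
        using y(3)[of j] q[of j] by (auto simp: indicator_def min_def)
    qed
    also have "\<dots> = B y \<omega> - B (q 0) \<omega>"
      unfolding sum_lessThan_telescope[of "\<lambda>j. B (min y (q j)) \<omega>"]
      using y by (simp add: min_absorb1 min_absorb2)
    finally show ?thesis .
  qed
  have "(\<Sum>j<N. elementary_process n p \<xi> (q (Suc j)) \<omega> * (B (q (Suc j)) \<omega> - B (q j) \<omega>))
      = (\<Sum>i<n. \<xi> i \<omega> * (\<Sum>j<N. indicator {p i<..p (Suc i)} (q (Suc j)) * (B (q (Suc j)) \<omega> - B (q j) \<omega>)))"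
    unfolding elementary_process_def sum_distrib_right sum_distrib_left
    by (subst sum.swap) (simp add: mult_ac)
  also have "\<dots> = (\<Sum>i<n. \<xi> i \<omega> * (B (p (Suc i)) \<omega> - B (p i) \<omega>))"
  proof (intro sum.cong refl arg_cong2[where f = "(*)"])
    fix i assume i: "i \<in> {..<n}"
    then have "indicator {p i<..p (Suc i)} x = (indicator {..p (Suc i)} x - indicator {..p i} x :: real)" for x
      using p[of i] by (auto simp: indicator_def)
    then have "(\<Sum>j<N. indicator {p i<..p (Suc i)} (q (Suc j)) * (B (q (Suc j)) \<omega> - B (q j) \<omega>))
      = (\<Sum>j<N. indicator {..p (Suc i)} (q (Suc j)) * (B (q (Suc j)) \<omega> - B (q j) \<omega>))
        - (\<Sum>j<N. indicator {..p i} (q (Suc j)) * (B (q (Suc j)) \<omega> - B (q j) \<omega>))"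
      by (simp add: left_diff_distrib sum_subtractf)
    also have "\<dots> = B (p (Suc i)) \<omega> - B (p i) \<omega>"
      using i range[of i] range[of "Suc i"] G by (subst (1 2) below) auto
    finally show "(\<Sum>j<N. indicator {p i<..p (Suc i)} (q (Suc j)) * (B (q (Suc j)) \<omega> - B (q j) \<omega>))
      = B (p (Suc i)) \<omega> - B (p i) \<omega>" .
  qed
  finally show ?thesis by (simp add: elementary_integral_def)
qed

lemma nn_integral_square_grid:
  fixes \<phi> :: "real \<Rightarrow> real"
  assumes q: "\<And>j. j < N \<Longrightarrow> q j < q (Suc j)"
    and const: "\<And>j r. j < N \<Longrightarrow> r \<in> {q j<..q (Suc j)} \<Longrightarrow> \<phi> r = c j"
    and zero: "\<And>r. r \<notin> {q 0<..q N} \<Longrightarrow> \<phi> r = 0"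
  shows "(\<integral>\<^sup>+r. ennreal ((\<phi> r)\<^sup>2) \<partial>lborel) = ennreal (\<Sum>j<N. (c j)\<^sup>2 * (q (Suc j) - q j))"
proof -
  have tel: "(\<Sum>j<N. indicator {q j<..q (Suc j)} r) = (indicator {q 0<..q N} r :: real)" for r
  proof -
    have mono: "q 0 \<le> q k" if "k \<le> N" for k
      using increasing_grid_mono[of N q] q that by blast
    have "(\<Sum>j<k. indicator {q j<..q (Suc j)} r) = (indicator {q 0<..q k} r :: real)" if "k \<le> N" for k
      using that
    proof (induction k)
      case (Suc k)
      then show ?case using q[of k] mono[of k] by (auto simp: indicator_def)
    qed simp
    then show ?thesis by simp
  qed
  have eq: "ennreal ((\<phi> r)\<^sup>2) = (\<Sum>j<N. ennreal ((c j)\<^sup>2) * indicator {q j<..q (Suc j)} r)" for r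
  proof -
    have "(\<phi> r)\<^sup>2 = (\<phi> r)\<^sup>2 * indicator {q 0<..q N} r"
      using zero[of r] by (auto simp: indicator_def)
    also have "\<dots> = (\<Sum>j<N. (\<phi> r)\<^sup>2 * indicator {q j<..q (Suc j)} r)"
      by (simp add: tel[symmetric] sum_distrib_left)
    also have "\<dots> = (\<Sum>j<N. (c j)\<^sup>2 * indicator {q j<..q (Suc j)} r)"
      using const by (intro sum.cong) (auto simp: indicator_def)
    finally have "ennreal ((\<phi> r)\<^sup>2) = ennreal (\<Sum>j<N. (c j)\<^sup>2 * indicator {q j<..q (Suc j)} r)" by simp
    also have "\<dots> = (\<Sum>j<N. ennreal ((c j)\<^sup>2 * indicator {q j<..q (Suc j)} r))"
      by (rule sum_ennreal[symmetric]) simp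
    finally show ?thesis by (simp add: ennreal_mult ennreal_indicator)
  qed
  have "(\<integral>\<^sup>+r. ennreal ((\<phi> r)\<^sup>2) \<partial>lborel)
      = (\<Sum>j<N. \<integral>\<^sup>+r. ennreal ((c j)\<^sup>2) * indicator {q j<..q (Suc j)} r \<partial>lborel)"
    unfolding eq by (rule nn_integral_sum) simp
  also have "\<dots> = (\<Sum>j<N. ennreal ((c j)\<^sup>2 * (q (Suc j) - q j)))"
    using q by (intro sum.cong) (auto simp: nn_integral_cmult_indicator ennreal_mult less_imp_le)
  also have "\<dots> = ennreal (\<Sum>j<N. (c j)\<^sup>2 * (q (Suc j) - q j))"
    using q by (intro sum_ennreal) (auto simp: less_imp_le)
  finally show ?thesis .
qed

context filtered_brownian_motion
begin

lemma elementary_data_points: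
  assumes "elementary_data F t n p \<xi>" "i \<le> n"
  shows "p i \<in> {0..t}"
proof -
  have mono: "p i \<le> p j" if "i \<le> j" "j \<le> n" for i j
    using increasing_grid_mono[of n p] assms(1) that unfolding elementary_data_def by blast
  show ?thesis
    using mono[of 0 i] mono[of i n] assms by (auto simp: elementary_data_def)
qed

lemma elementary_process_zero:
  assumes "elementary_data F t n p \<xi>" "r \<notin> {0<..t}"
  shows "elementary_process n p \<xi> r \<omega> = 0"
proof -
  have "r \<notin> {p i<..p (Suc i)}" if "i < n" for i
    using elementary_data_points[OF assms(1), of i] elementary_data_points[OF assms(1), of "Suc i"]
      assms(2) that
    by auto
  then show ?thesis
    unfolding elementary_process_def by (intro sum.neutral) auto
qed

text \<open>
  The value on the cell \<open>(a, b]\<close> is a coefficient \<open>\<xi> i\<close> with \<open>p i < b\<close>, hence with \<open>p i \<le> a\<close>, or zero.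
\<close>

lemma elementary_process_grid_measurable:
  assumes el: "elementary_data F t n p \<xi>"
    and G: "\<And>i. i \<le> n \<Longrightarrow> p i \<le> a \<or> b \<le> p i" and a: "a < b" "a \<le> T"
  shows "(\<lambda>\<omega>. elementary_process n p \<xi> b \<omega>) \<in> borel_measurable (F a)"
  unfolding elementary_process_def
proof (intro borel_measurable_sum)
  fix i assume i: "i \<in> {..<n}"
  show "(\<lambda>\<omega>. \<xi> i \<omega> * indicator {p i<..p (Suc i)} b) \<in> borel_measurable (F a)"
  proof (cases "b \<in> {p i<..p (Suc i)}")
    case True
    then have "p i \<le> a" using G[of i] i by auto
    moreover have "0 \<le> p i" using elementary_data_points[OF el, of i] i by auto
    moreover have "\<xi> i \<in> borel_measurable (F (p i))" using el i by (auto simp: elementary_data_def)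
    ultimately have "\<xi> i \<in> borel_measurable (F a)" using a by (auto intro: measurable_filtration_mono)
    then show ?thesis by simp
  qed simp
qed

text \<open>
  On a grid that contains both partitions, the difference of the two elementary processes is again
  elementary.
\<close>

lemma exp_martingale_elementary_diff:
  fixes lam :: real
  assumes s: "s \<in> {0..T}" and t: "t \<in> {0..T}"
    and el1: "elementary_data F s n p \<xi>" and el2: "elementary_data F t n' p' \<xi>'"
  shows "(\<integral>\<^sup>+\<omega>. ennreal (exp (lam * (elementary_integral B n' p' \<xi>' \<omega> - elementary_integral B n p \<xi> \<omega>)
      - lam\<^sup>2 / 2 * enn2real (\<integral>\<^sup>+r. ennreal ((elementary_process n' p' \<xi>' r \<omega>
          - elementary_process n p \<xi> r \<omega>)\<^sup>2) \<partial>lborel))) \<partial>M) = 1"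
proof -
  define P where "P = p ` {..n} \<union> p' ` {..n'}"
  have P: "finite P" "P \<noteq> {}" "P \<subseteq> {0..T}"
    using elementary_data_points[OF el1] elementary_data_points[OF el2] s t by (fastforce simp: P_def)+
  have "p 0 = 0" using el1 by (auto simp: elementary_data_def)
  then have "0 \<in> P" by (auto simp: P_def intro!: rev_image_eqI[of 0])
  then have MinP: "Min P = 0" using P by (intro Min_eqI) auto
  have MaxP: "Max P \<le> T" using P by auto
  obtain N q where q: "\<And>j. j < N \<Longrightarrow> q j < q (Suc j)" and q0: "q 0 = 0" and qN: "q N = Max P"
    and gap: "\<And>x j. x \<in> P \<Longrightarrow> j < N \<Longrightarrow> x \<le> q j \<or> q (Suc j) \<le> x"
    using sorted_grid_exists[OF P(1,2)] MinP by metis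
  have mono: "q i \<le> q j" if "i \<le> j" "j \<le> N" for i j
    using increasing_grid_mono[of N q] q that by blast
  have inP: "\<And>i. i \<le> n \<Longrightarrow> p i \<in> P" "\<And>i. i \<le> n' \<Longrightarrow> p' i \<in> P" by (auto simp: P_def)
  have rng: "q 0 \<le> x \<and> x \<le> q N" if "x \<in> P" for x
    using that P q0 qN by auto
  define c where "c j \<omega> = elementary_process n' p' \<xi>' (q (Suc j)) \<omega> - elementary_process n p \<xi> (q (Suc j)) \<omega>" for j \<omega>
  have qT: "q j \<le> T" if "j \<le> N" for j
    using mono[of j N] that qN MaxP by auto
  have c_meas: "c j \<in> borel_measurable (F (q j))" if j: "j < N" for j
    unfolding c_def
    by (intro borel_measurable_diff elementary_process_grid_measurable[OF el1]
        elementary_process_grid_measurable[OF el2] gap inP j q qT) (use j in auto)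
  have int: "elementary_integral B n' p' \<xi>' \<omega> - elementary_integral B n p \<xi> \<omega>
      = (\<Sum>j<N. c j \<omega> * (B (q (Suc j)) \<omega> - B (q j) \<omega>))" for \<omega>
  proof -
    have "(\<Sum>j<N. elementary_process n p \<xi> (q (Suc j)) \<omega> * (B (q (Suc j)) \<omega> - B (q j) \<omega>))
        = elementary_integral B n p \<xi> \<omega>"
      using el1 by (intro elementary_integral_refine q gap inP rng) (auto simp: elementary_data_def)
    moreover have "(\<Sum>j<N. elementary_process n' p' \<xi>' (q (Suc j)) \<omega> * (B (q (Suc j)) \<omega> - B (q j) \<omega>))
        = elementary_integral B n' p' \<xi>' \<omega>"
      using el2 by (intro elementary_integral_refine q gap inP rng) (auto simp: elementary_data_def)
    ultimately show ?thesis
      by (simp add: c_def left_diff_distrib sum_subtractf)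
  qed
  have var: "(\<integral>\<^sup>+r. ennreal ((elementary_process n' p' \<xi>' r \<omega> - elementary_process n p \<xi> r \<omega>)\<^sup>2) \<partial>lborel)
      = ennreal (\<Sum>j<N. (c j \<omega>)\<^sup>2 * (q (Suc j) - q j))" for \<omega>
  proof (rule nn_integral_square_grid)
    show "q j < q (Suc j)" if "j < N" for j using q that .
  next
    fix j r assume "j < N" "r \<in> {q j<..q (Suc j)}"
    then show "elementary_process n' p' \<xi>' r \<omega> - elementary_process n p \<xi> r \<omega> = c j \<omega>"
      unfolding c_def
      by (intro arg_cong2[where f = "(-)"] elementary_process_grid_const[where a = "q j"] gap inP)
  next
    fix r assume r: "r \<notin> {q 0<..q N}"
    have "p n = s" "p' n' = t" using el1 el2 by (auto simp: elementary_data_def)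
    then have "s \<le> q N" "t \<le> q N" using rng[OF inP(1)[of n]] rng[OF inP(2)[of n']] by auto
    then have "r \<notin> {0<..s}" "r \<notin> {0<..t}" using r q0 by auto
    then show "elementary_process n' p' \<xi>' r \<omega> - elementary_process n p \<xi> r \<omega> = 0"
      using elementary_process_zero[OF el1] elementary_process_zero[OF el2] by simp
  qed
  have "0 \<le> (\<Sum>j<N. (c j \<omega>)\<^sup>2 * (q (Suc j) - q j))" for \<omega>
    using q by (intro sum_nonneg mult_nonneg_nonneg) (auto simp: less_imp_le)
  then have "lam * (elementary_integral B n' p' \<xi>' \<omega> - elementary_integral B n p \<xi> \<omega>)
      - lam\<^sup>2 / 2 * enn2real (\<integral>\<^sup>+r. ennreal ((elementary_process n' p' \<xi>' r \<omega>
          - elementary_process n p \<xi> r \<omega>)\<^sup>2) \<partial>lborel)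
     = (\<Sum>j<N. (lam * c j \<omega>) * (B (q (Suc j)) \<omega> - B (q j) \<omega>)
         - 1 / 2 * (lam * c j \<omega>)\<^sup>2 * (q (Suc j) - q j))" for \<omega>
    unfolding var int by (simp add: sum_subtractf sum_distrib_left power_mult_distrib mult_ac)
  moreover have "(\<integral>\<^sup>+\<omega>. ennreal (exp (\<Sum>j<N. (lam * c j \<omega>) * (B (q (Suc j)) \<omega> - B (q j) \<omega>)
         - 1 / 2 * (lam * c j \<omega>)\<^sup>2 * (q (Suc j) - q j))) \<partial>M) = 1"
    using c_meas q0 qT by (intro exp_martingale_grid q) auto
  ultimately show "(\<integral>\<^sup>+\<omega>. ennreal (exp (lam * (elementary_integral B n' p' \<xi>' \<omega> - elementary_integral B n p \<xi> \<omega>)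
      - lam\<^sup>2 / 2 * enn2real (\<integral>\<^sup>+r. ennreal ((elementary_process n' p' \<xi>' r \<omega>
          - elementary_process n p \<xi> r \<omega>)\<^sup>2) \<partial>lborel))) \<partial>M) = 1"
    by simp
qed

end

section \<open>Exponential moments of Ito integrals\<close>

text \<open>
  Joint measurability is only assumed for times in \<open>[0,t]\<close>. Composing with the projection of the
  line onto this interval gives a function on the whole line that agrees with the process where the
  indicator is not zero.
\<close>

lemma process_measurable_extend:
  assumes f: "measurable_process M t f" and t: "0 \<le> t"
  shows "(\<lambda>(\<omega>, r). indicator {0..t} r * f r \<omega>) \<in> borel_measurable (M \<Otimes>\<^sub>M borel)"
proof -
  have clamp: "(\<lambda>r. max 0 (min r t)) \<in> measurable borel (restrict_space borel {0..t})"
    using t by (intro measurable_restrict_space2) auto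
  have "(\<lambda>(r, \<omega>). f r \<omega>) \<in> borel_measurable (restrict_space borel {0..t} \<Otimes>\<^sub>M M)"
    using f by (simp add: measurable_process_def)
  moreover have "(\<lambda>x. (max 0 (min (snd x) t), fst x)) \<in> measurable (M \<Otimes>\<^sub>M borel) (restrict_space borel {0..t} \<Otimes>\<^sub>M M)"
    using measurable_compose[OF measurable_snd clamp] by (intro measurable_Pair) auto
  ultimately have "(\<lambda>x. f (max 0 (min (snd x) t)) (fst x)) \<in> borel_measurable (M \<Otimes>\<^sub>M borel)"
    by (auto dest: measurable_compose[rotated])
  then have "(\<lambda>x. indicator {0..t} (snd x) * f (max 0 (min (snd x) t)) (fst x)) \<in> borel_measurable (M \<Otimes>\<^sub>M borel)"
    by measurable
  also have "(\<lambda>x. indicator {0..t} (snd x) * f (max 0 (min (snd x) t)) (fst x))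
      = (\<lambda>(\<omega>, r). indicator {0..t} r * f r \<omega>)"
    by (auto simp: indicator_def fun_eq_iff max_absorb2 min_absorb1)
  finally show ?thesis .
qed

text \<open>
  The pointwise series has finite expectation, so it converges almost surely and its terms vanish
  in the limit.
\<close>

lemma AE_tendsto_0_if_suminf_nn_integral:
  fixes u :: "nat \<Rightarrow> 'a \<Rightarrow> ennreal"
  assumes [measurable]: "\<And>k. u k \<in> borel_measurable M"
    and fin: "(\<Sum>k. \<integral>\<^sup>+x. u k x \<partial>M) < top"
  shows "AE x in M. (\<lambda>k. u k x) \<longlonglongrightarrow> 0"
proof -
  have "(\<integral>\<^sup>+x. (\<Sum>k. u k x) \<partial>M) = (\<Sum>k. \<integral>\<^sup>+x. u k x \<partial>M)"
    by (rule nn_integral_suminf) simp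
  then have "AE x in M. (\<Sum>k. u k x) \<noteq> \<infinity>"
    using fin by (intro nn_integral_noteq_infinite) auto
  then show ?thesis
  proof eventually_elim
    fix x assume x: "(\<Sum>k. u k x) \<noteq> \<infinity>"
    have fin: "u k x < top" for k
      using ennreal_suminf_lessD[of "\<lambda>k. u k x" top k] x by (simp add: less_top)
    then have eq: "u k x = ennreal (enn2real (u k x))" for k by simp
    have "summable (\<lambda>k. enn2real (u k x))"
      using x eq by (intro summable_suminf_not_top) auto
    then have "(\<lambda>k. enn2real (u k x)) \<longlonglongrightarrow> 0"
      by (rule summable_LIMSEQ_zero)
    then have "(\<lambda>k. ennreal (enn2real (u k x))) \<longlonglongrightarrow> ennreal 0"
      by (rule tendsto_ennrealI)
    then show "(\<lambda>k. u k x) \<longlonglongrightarrow> 0"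
      using eq by simp
  qed
qed

lemma suminf_ennreal_le_geometric:
  fixes u :: "nat \<Rightarrow> ennreal"
  assumes "\<And>k. u k \<le> ennreal (K * \<theta> ^ k)" "0 \<le> K" "0 \<le> \<theta>" "\<theta> < 1"
  shows "(\<Sum>k. u k) < top"
proof -
  have "(\<Sum>k. u k) \<le> (\<Sum>k. ennreal (K * \<theta> ^ k))"
    using assms(1) by (intro suminf_le) auto
  also have "\<dots> = ennreal (\<Sum>k. K * \<theta> ^ k)"
    using assms by (intro suminf_ennreal2 summable_mult summable_geometric) auto
  also have "\<dots> < top" by simp
  finally show ?thesis .
qed

lemma tendsto_0_AE_subseq:
  fixes u :: "nat \<Rightarrow> 'a \<Rightarrow> ennreal"
  assumes "\<And>k. u k \<in> borel_measurable M"
    and lim: "(\<lambda>k. \<integral>\<^sup>+x. u k x \<partial>M) \<longlonglongrightarrow> 0"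
  obtains r :: "nat \<Rightarrow> nat" where "AE x in M. (\<lambda>k. u (r k) x) \<longlonglongrightarrow> 0"
proof -
  have "\<exists>n. (\<integral>\<^sup>+x. u n x \<partial>M) < ennreal (1 * (1 / 2) ^ k)" for k
    using order_tendstoD(2)[OF lim, of "ennreal ((1 / 2) ^ k)"]
    by (auto simp: eventually_sequentially)
  then obtain r where r: "\<And>k. (\<integral>\<^sup>+x. u (r k) x \<partial>M) < ennreal (1 * (1 / 2) ^ k)"
    by metis
  have "(\<Sum>k. \<integral>\<^sup>+x. u (r k) x \<partial>M) < top"
    by (rule suminf_ennreal_le_geometric[of _ 1 "1 / 2"]) (use r in \<open>auto simp: less_imp_le\<close>)
  then show thesis
    by (intro that[of r] AE_tendsto_0_if_suminf_nn_integral assms(1))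
qed

lemma power_le_fact_exp:
  fixes x :: real
  assumes "0 \<le> x"
  shows "x ^ p \<le> fact p * exp x"
proof -
  have "(\<Sum>k\<in>{p}. x ^ k /\<^sub>R fact k) \<le> (\<Sum>k. x ^ k /\<^sub>R fact k)"
    using assms summable_exp_generic[of x] by (intro sum_le_suminf) auto
  then have "x ^ p / fact p \<le> exp x" by (simp add: exp_def divide_inverse mult.commute)
  then show ?thesis by (simp add: field_simps)
qed

context filtered_brownian_motion
begin

lemma elementary_data_measurable:
  assumes "elementary_data F t n p \<xi>" "t \<le> T" "i < n"
  shows "\<xi> i \<in> borel_measurable M"
proof -
  have "p i \<in> {0..T}" using elementary_data_points[OF assms(1), of i] assms by auto
  moreover have "\<xi> i \<in> borel_measurable (F (p i))" using assms by (auto simp: elementary_data_def)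
  ultimately show ?thesis by (metis measurable_from_filtration)
qed

lemma elementary_process_measurable:
  assumes "elementary_data F t n p \<xi>" "t \<le> T"
  shows "(\<lambda>(\<omega>, r). elementary_process n p \<xi> r \<omega>) \<in> borel_measurable (M \<Otimes>\<^sub>M borel)"
proof -
  have [measurable]: "\<xi> i \<in> borel_measurable M" if "i \<in> {..<n}" for i
    using elementary_data_measurable[OF assms] that by simp
  show ?thesis unfolding elementary_process_def by measurable
qed

lemma elementary_integral_measurable:
  assumes "elementary_data F t n p \<xi>" "t \<le> T"
  shows "elementary_integral B n p \<xi> \<in> borel_measurable M"
proof -
  have "\<xi> i \<in> borel_measurable M" "B (p i) \<in> borel_measurable M" "B (p (Suc i)) \<in> borel_measurable M"
    if "i < n" for i
    using elementary_data_measurable[OF assms that] elementary_data_points[OF assms(1), of i]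
      elementary_data_points[OF assms(1), of "Suc i"] assms(2) that
    by (auto intro!: brownian_measurable)
  then show ?thesis
    unfolding elementary_integral_def by (intro borel_measurable_sum borel_measurable_times borel_measurable_diff) auto
qed

text \<open>
  Elementary processes on \<open>[0,t]\<close> vanish outside \<open>(0,t]\<close>, so the approximation holds on the whole line
  for the integrand extended by zero. This puts integrals up to different times on the same footing.
\<close>

lemma ito_integral_approx:
  assumes I: "has_ito_integral M F B t f I" and t: "t \<in> {0..T}"
  obtains n p \<xi> where "\<And>k. elementary_data F t (n k) (p k) (\<xi> k)"
    and "(\<lambda>k. \<integral>\<^sup>+\<omega>. (\<integral>\<^sup>+r. ennreal ((indicator {0..t} r * f r \<omega>
          - elementary_process (n k) (p k) (\<xi> k) r \<omega>)\<^sup>2) \<partial>lborel) \<partial>M) \<longlonglongrightarrow> 0"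
    and "(\<lambda>k. \<integral>\<^sup>+\<omega>. ennreal ((I \<omega> - elementary_integral B (n k) (p k) (\<xi> k) \<omega>)\<^sup>2) \<partial>M) \<longlonglongrightarrow> 0"
proof -
  obtain n p \<xi> where el: "\<And>k. elementary_data F t (n k) (p k) (\<xi> k)"
    and lim: "(\<lambda>k. \<integral>\<^sup>+\<omega>. (\<integral>\<^sup>+s\<in>{0..t}.
               ennreal ((f s \<omega> - elementary_process (n k) (p k) (\<xi> k) s \<omega>)\<^sup>2) \<partial>lborel) \<partial>M) \<longlonglongrightarrow> 0"
      "(\<lambda>k. \<integral>\<^sup>+\<omega>. ennreal ((I \<omega> - elementary_integral B (n k) (p k) (\<xi> k) \<omega>)\<^sup>2) \<partial>M) \<longlonglongrightarrow> 0"
    using I unfolding has_ito_integral_def by blast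
  have "ennreal ((f r \<omega> - elementary_process (n k) (p k) (\<xi> k) r \<omega>)\<^sup>2) * indicator {0..t} r
      = ennreal ((indicator {0..t} r * f r \<omega> - elementary_process (n k) (p k) (\<xi> k) r \<omega>)\<^sup>2)" for r k \<omega>
    using elementary_process_zero[OF el, of r k \<omega>] by (cases "r \<in> {0..t}") auto
  then show thesis using that[OF el] lim by simp
qed

text \<open>
  The approximating elementary integrands \<open>\<phi>\<close>, \<open>\<phi>'\<close> need not satisfy the bound \<open>Q\<close>, but
  \<open>\<integral> (\<phi>' - \<phi>)\<^sup>2 \<le> 3 (Q + \<epsilon>)\<close>, where \<open>\<epsilon>\<close> is the sum of their squared distances to the integrands. Along a
  subsequence \<open>\<epsilon>\<close> tends to zero and the elementary integrals converge, almost surely, and Fatou's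
  lemma applies to the exponential martingales. The factor 3 is that of
  \<open>(x + y + z)\<^sup>2 \<le> 3 (x\<^sup>2 + y\<^sup>2 + z\<^sup>2)\<close>.
\<close>

lemma exp_moment_ito_diff:
  fixes lam Q :: real
  assumes s: "s \<in> {0..T}" and t: "t \<in> {0..T}"
    and I1: "has_ito_integral M F B s f I" and I2: "has_ito_integral M F B t f' I'"
    and Q: "0 \<le> Q"
    and bound: "\<And>\<omega>. \<omega> \<in> space M \<Longrightarrow>
      (\<integral>\<^sup>+r. ennreal ((indicator {0..t} r * f' r \<omega> - indicator {0..s} r * f r \<omega>)\<^sup>2) \<partial>lborel) \<le> ennreal Q"
  shows "(\<integral>\<^sup>+\<omega>. ennreal (exp (lam * (I' \<omega> - I \<omega>))) \<partial>M) \<le> ennreal (exp (3 / 2 * lam\<^sup>2 * Q))"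
proof -
  define \<psi> where "\<psi> r \<omega> = indicator {0..s} r * f r \<omega>" for r \<omega>
  define \<psi>' where "\<psi>' r \<omega> = indicator {0..t} r * f' r \<omega>" for r \<omega>
  obtain n p \<xi> where el: "\<And>k. elementary_data F s (n k) (p k) (\<xi> k)"
    and lim1: "(\<lambda>k. \<integral>\<^sup>+\<omega>. (\<integral>\<^sup>+r. ennreal ((\<psi> r \<omega> - elementary_process (n k) (p k) (\<xi> k) r \<omega>)\<^sup>2) \<partial>lborel) \<partial>M) \<longlonglongrightarrow> 0"
    and lim2: "(\<lambda>k. \<integral>\<^sup>+\<omega>. ennreal ((I \<omega> - elementary_integral B (n k) (p k) (\<xi> k) \<omega>)\<^sup>2) \<partial>M) \<longlonglongrightarrow> 0"
    using ito_integral_approx[OF I1 s] unfolding \<psi>_def by blast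
  obtain n' p' \<xi>' where el': "\<And>k. elementary_data F t (n' k) (p' k) (\<xi>' k)"
    and lim1': "(\<lambda>k. \<integral>\<^sup>+\<omega>. (\<integral>\<^sup>+r. ennreal ((\<psi>' r \<omega> - elementary_process (n' k) (p' k) (\<xi>' k) r \<omega>)\<^sup>2) \<partial>lborel) \<partial>M) \<longlonglongrightarrow> 0"
    and lim2': "(\<lambda>k. \<integral>\<^sup>+\<omega>. ennreal ((I' \<omega> - elementary_integral B (n' k) (p' k) (\<xi>' k) \<omega>)\<^sup>2) \<partial>M) \<longlonglongrightarrow> 0"
    using ito_integral_approx[OF I2 t] unfolding \<psi>'_def by blast
  define \<phi> where "\<phi> k r \<omega> = elementary_process (n k) (p k) (\<xi> k) r \<omega>" for k r \<omega>
  define \<phi>' where "\<phi>' k r \<omega> = elementary_process (n' k) (p' k) (\<xi>' k) r \<omega>" for k r \<omega>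
  define J where "J k = elementary_integral B (n k) (p k) (\<xi> k)" for k
  define J' where "J' k = elementary_integral B (n' k) (p' k) (\<xi>' k)" for k
  have T: "s \<le> T" "t \<le> T" "0 \<le> s" "0 \<le> t" using s t by auto
  have [measurable]: "I \<in> borel_measurable M" "I' \<in> borel_measurable M"
    using I1 I2 by (auto simp: has_ito_integral_def)
  have [measurable]: "J k \<in> borel_measurable M" "J' k \<in> borel_measurable M" for k
    unfolding J_def J'_def
    using elementary_integral_measurable[OF el] elementary_integral_measurable[OF el'] T by auto
  have [measurable]: "(\<lambda>(\<omega>, r). \<phi> k r \<omega>) \<in> borel_measurable (M \<Otimes>\<^sub>M borel)"
      "(\<lambda>(\<omega>, r). \<phi>' k r \<omega>) \<in> borel_measurable (M \<Otimes>\<^sub>M borel)" for k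
    unfolding \<phi>_def \<phi>'_def
    using elementary_process_measurable[OF el] elementary_process_measurable[OF el'] T by auto
  have [measurable]: "(\<lambda>(\<omega>, r). \<psi> r \<omega>) \<in> borel_measurable (M \<Otimes>\<^sub>M borel)"
      "(\<lambda>(\<omega>, r). \<psi>' r \<omega>) \<in> borel_measurable (M \<Otimes>\<^sub>M borel)"
    unfolding \<psi>_def \<psi>'_def
    using I1 I2 T by (auto simp: has_ito_integral_def intro!: process_measurable_extend)
  define a where "a k \<omega> = (\<integral>\<^sup>+r. ennreal ((\<psi> r \<omega> - \<phi> k r \<omega>)\<^sup>2) \<partial>lborel)" for k \<omega>
  define a' where "a' k \<omega> = (\<integral>\<^sup>+r. ennreal ((\<psi>' r \<omega> - \<phi>' k r \<omega>)\<^sup>2) \<partial>lborel)" for k \<omega>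
  define V where "V k \<omega> = (\<integral>\<^sup>+r. ennreal ((\<phi>' k r \<omega> - \<phi> k r \<omega>)\<^sup>2) \<partial>lborel)" for k \<omega>
  have [measurable]: "a k \<in> borel_measurable M" "a' k \<in> borel_measurable M" "V k \<in> borel_measurable M" for k
    unfolding a_def a'_def V_def by measurable
  define c where "c k \<omega> = ennreal ((I \<omega> - J k \<omega>)\<^sup>2)" for k \<omega>
  define c' where "c' k \<omega> = ennreal ((I' \<omega> - J' k \<omega>)\<^sup>2)" for k \<omega>
  have [measurable]: "c k \<in> borel_measurable M" "c' k \<in> borel_measurable M" for k
    unfolding c_def c'_def by measurable
  define u where "u k \<omega> = (a k \<omega> + a' k \<omega>) + (c k \<omega> + c' k \<omega>)" for k \<omega>
  have [measurable]: "u k \<in> borel_measurable M" for k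
    unfolding u_def by measurable
  have "(\<lambda>k. ((\<integral>\<^sup>+\<omega>. a k \<omega> \<partial>M) + (\<integral>\<^sup>+\<omega>. a' k \<omega> \<partial>M)) + ((\<integral>\<^sup>+\<omega>. c k \<omega> \<partial>M) + (\<integral>\<^sup>+\<omega>. c' k \<omega> \<partial>M)))
      \<longlonglongrightarrow> (0 + 0) + (0 + 0)"
    unfolding a_def a'_def c_def c'_def \<phi>_def \<phi>'_def J_def J'_def
    by (intro tendsto_add lim1 lim1' lim2 lim2')
  then have "(\<lambda>k. \<integral>\<^sup>+\<omega>. u k \<omega> \<partial>M) \<longlonglongrightarrow> 0"
    unfolding u_def by (simp add: nn_integral_add)
  then obtain \<rho> :: "nat \<Rightarrow> nat" where \<rho>: "AE \<omega> in M. (\<lambda>k. u (\<rho> k) \<omega>) \<longlonglongrightarrow> 0"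
    using tendsto_0_AE_subseq[of u M] by auto
  define G where "G k \<omega> = ennreal (exp (lam * (J' k \<omega> - J k \<omega>) - lam\<^sup>2 / 2 * enn2real (V k \<omega>)))" for k \<omega>
  have [measurable]: "G k \<in> borel_measurable M" for k
    unfolding G_def by measurable
  have G_int: "(\<integral>\<^sup>+\<omega>. G k \<omega> \<partial>M) = 1" for k
    unfolding G_def V_def \<phi>_def \<phi>'_def J_def J'_def
    by (rule exp_martingale_elementary_diff[OF s t el el'])
  have liminf: "AE \<omega> in M. ennreal (exp (lam * (I' \<omega> - I \<omega>) - 3 / 2 * lam\<^sup>2 * Q)) \<le> liminf (\<lambda>k. G (\<rho> k) \<omega>)"
    using \<rho> AE_space
  proof eventually_elim
    fix \<omega> assume lim: "(\<lambda>k. u (\<rho> k) \<omega>) \<longlonglongrightarrow> 0" and \<omega>: "\<omega> \<in> space M"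
    have squeeze: "(\<lambda>k. v (\<rho> k) \<omega>) \<longlonglongrightarrow> 0" if "\<And>k. v k \<omega> \<le> u k \<omega>" for v :: "nat \<Rightarrow> 'a \<Rightarrow> ennreal"
      by (rule tendsto_sandwich[OF _ _ tendsto_const lim]) (auto simp: that)
    have "(\<lambda>k. c (\<rho> k) \<omega>) \<longlonglongrightarrow> 0" "(\<lambda>k. c' (\<rho> k) \<omega>) \<longlonglongrightarrow> 0"
      by (intro squeeze; simp add: u_def add_increasing add_increasing2)+
    then have "(\<lambda>k. (I \<omega> - J (\<rho> k) \<omega>)\<^sup>2) \<longlonglongrightarrow> 0" "(\<lambda>k. (I' \<omega> - J' (\<rho> k) \<omega>)\<^sup>2) \<longlonglongrightarrow> 0"
      unfolding c_def c'_def by (simp_all add: ennreal_tendsto_0_iff)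
    from tendsto_real_sqrt[OF this(1)] tendsto_real_sqrt[OF this(2)]
    have "(\<lambda>k. I \<omega> - J (\<rho> k) \<omega>) \<longlonglongrightarrow> 0" "(\<lambda>k. I' \<omega> - J' (\<rho> k) \<omega>) \<longlonglongrightarrow> 0"
      by (simp_all add: tendsto_rabs_zero_iff)
    then have J_lim: "(\<lambda>k. J (\<rho> k) \<omega>) \<longlonglongrightarrow> I \<omega>" "(\<lambda>k. J' (\<rho> k) \<omega>) \<longlonglongrightarrow> I' \<omega>"
      by (auto dest: tendsto_diff[OF tendsto_const[of "I \<omega>"]] tendsto_diff[OF tendsto_const[of "I' \<omega>"]])
    define e where "e k = a (\<rho> k) \<omega> + a' (\<rho> k) \<omega>" for k
    have e_lim: "e \<longlonglongrightarrow> 0"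
      unfolding e_def using squeeze[of "\<lambda>k \<omega>. a k \<omega> + a' k \<omega>"] by (simp add: u_def add_increasing2)
    then have e_real: "(\<lambda>k. enn2real (e k)) \<longlonglongrightarrow> 0"
      using tendsto_enn2real[of e 0 sequentially] by simp
    have e_fin: "\<forall>\<^sub>F k in sequentially. e k < top"
      using order_tendstoD(2)[OF e_lim, of top] by simp
    have V_le: "V k \<omega> \<le> 3 * (ennreal Q + (a k \<omega> + a' k \<omega>))" for k
    proof -
      have [measurable]: "(\<lambda>r. \<phi> k r \<omega>) \<in> borel_measurable borel" "(\<lambda>r. \<phi>' k r \<omega>) \<in> borel_measurable borel"
          "(\<lambda>r. \<psi> r \<omega>) \<in> borel_measurable borel" "(\<lambda>r. \<psi>' r \<omega>) \<in> borel_measurable borel" for k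
        using \<omega> by measurable
      have sq: "(x - w)\<^sup>2 \<le> 3 * ((y - z)\<^sup>2 + ((z - w)\<^sup>2 + (y - x)\<^sup>2))" for x y z w :: real
        by sos
      have "V k \<omega> \<le> (\<integral>\<^sup>+r. 3 * (ennreal ((\<psi>' r \<omega> - \<psi> r \<omega>)\<^sup>2)
          + (ennreal ((\<psi> r \<omega> - \<phi> k r \<omega>)\<^sup>2) + ennreal ((\<psi>' r \<omega> - \<phi>' k r \<omega>)\<^sup>2))) \<partial>lborel)"
        unfolding V_def
      proof (intro nn_integral_mono)
        fix r
        have "ennreal ((\<phi>' k r \<omega> - \<phi> k r \<omega>)\<^sup>2) \<le> ennreal (3 * ((\<psi>' r \<omega> - \<psi> r \<omega>)\<^sup>2
            + ((\<psi> r \<omega> - \<phi> k r \<omega>)\<^sup>2 + (\<psi>' r \<omega> - \<phi>' k r \<omega>)\<^sup>2)))"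
          by (intro ennreal_leI sq)
        then show "ennreal ((\<phi>' k r \<omega> - \<phi> k r \<omega>)\<^sup>2) \<le> 3 * (ennreal ((\<psi>' r \<omega> - \<psi> r \<omega>)\<^sup>2)
          + (ennreal ((\<psi> r \<omega> - \<phi> k r \<omega>)\<^sup>2) + ennreal ((\<psi>' r \<omega> - \<phi>' k r \<omega>)\<^sup>2)))"
          by (simp add: ennreal_mult)
      qed
      also have "\<dots> = 3 * ((\<integral>\<^sup>+r. ennreal ((\<psi>' r \<omega> - \<psi> r \<omega>)\<^sup>2) \<partial>lborel) + (a k \<omega> + a' k \<omega>))"
        unfolding a_def a'_def by (simp add: nn_integral_cmult nn_integral_add)
      also have "\<dots> \<le> 3 * (ennreal Q + (a k \<omega> + a' k \<omega>))"
        using bound[OF \<omega>] unfolding \<psi>_def \<psi>'_def by (intro mult_left_mono add_right_mono) auto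
      finally show ?thesis .
    qed
    define L where "L k = ennreal (exp (lam * (J' (\<rho> k) \<omega> - J (\<rho> k) \<omega>) - lam\<^sup>2 / 2 * (3 * (Q + enn2real (e k)))))" for k
    have "L \<longlonglongrightarrow> ennreal (exp (lam * (I' \<omega> - I \<omega>) - lam\<^sup>2 / 2 * (3 * (Q + 0))))"
      unfolding L_def by (intro tendsto_ennrealI tendsto_intros J_lim e_real)
    then have "ennreal (exp (lam * (I' \<omega> - I \<omega>) - 3 / 2 * lam\<^sup>2 * Q)) = liminf L"
      by (simp add: lim_imp_Liminf mult_ac)
    also have "\<dots> \<le> liminf (\<lambda>k. G (\<rho> k) \<omega>)"
    proof (rule Liminf_mono)
      show "\<forall>\<^sub>F k in sequentially. L k \<le> G (\<rho> k) \<omega>"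
        using e_fin
      proof eventually_elim
        fix k assume fin: "e k < top"
        have "V (\<rho> k) \<omega> \<le> 3 * (ennreal Q + e k)"
          using V_le[of "\<rho> k"] by (simp add: e_def)
        also have "\<dots> = ennreal (3 * (Q + enn2real (e k)))"
          using fin Q by (simp add: ennreal_mult)
        finally have "enn2real (V (\<rho> k) \<omega>) \<le> 3 * (Q + enn2real (e k))"
          using Q by (intro enn2real_leI) auto
        then show "L k \<le> G (\<rho> k) \<omega>"
          unfolding L_def G_def
          by (intro ennreal_leI exp_le_cancel_iff[THEN iffD2] diff_left_mono mult_left_mono) auto
      qed
    qed
    finally show "ennreal (exp (lam * (I' \<omega> - I \<omega>) - 3 / 2 * lam\<^sup>2 * Q)) \<le> liminf (\<lambda>k. G (\<rho> k) \<omega>)" .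
  qed
  have "(\<integral>\<^sup>+\<omega>. ennreal (exp (lam * (I' \<omega> - I \<omega>) - 3 / 2 * lam\<^sup>2 * Q)) \<partial>M)
      \<le> (\<integral>\<^sup>+\<omega>. liminf (\<lambda>k. G (\<rho> k) \<omega>) \<partial>M)"
    by (rule nn_integral_mono_AE[OF liminf])
  also have "\<dots> \<le> liminf (\<lambda>k. \<integral>\<^sup>+\<omega>. G (\<rho> k) \<omega> \<partial>M)"
    by (rule nn_integral_liminf) simp
  also have "\<dots> = 1" by (simp add: G_int Liminf_const)
  finally have le1: "(\<integral>\<^sup>+\<omega>. ennreal (exp (lam * (I' \<omega> - I \<omega>) - 3 / 2 * lam\<^sup>2 * Q)) \<partial>M) \<le> 1" .
  have "(\<integral>\<^sup>+\<omega>. ennreal (exp (lam * (I' \<omega> - I \<omega>))) \<partial>M)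
      = (\<integral>\<^sup>+\<omega>. ennreal (exp (3 / 2 * lam\<^sup>2 * Q)) * ennreal (exp (lam * (I' \<omega> - I \<omega>) - 3 / 2 * lam\<^sup>2 * Q)) \<partial>M)"
    by (simp add: ennreal_mult[symmetric] exp_add[symmetric])
  also have "\<dots> = ennreal (exp (3 / 2 * lam\<^sup>2 * Q)) * (\<integral>\<^sup>+\<omega>. ennreal (exp (lam * (I' \<omega> - I \<omega>) - 3 / 2 * lam\<^sup>2 * Q)) \<partial>M)"
    by (rule nn_integral_cmult) measurable
  also have "\<dots> \<le> ennreal (exp (3 / 2 * lam\<^sup>2 * Q)) * 1"
    by (intro mult_left_mono le1) simp
  finally show ?thesis by simp
qed

text \<open>
  Apply the exponential bound with \<open>\<lambda> = 1 / sqrt Q\<close> and \<open>\<lambda> = - 1 / sqrt Q\<close>, and estimate a power by the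
  exponential series.
\<close>

lemma moment_ito_diff:
  fixes Q :: real
  assumes s: "s \<in> {0..T}" and t: "t \<in> {0..T}"
    and I1: "has_ito_integral M F B s f I" and I2: "has_ito_integral M F B t f' I'"
    and Q: "0 < Q"
    and bound: "\<And>\<omega>. \<omega> \<in> space M \<Longrightarrow>
      (\<integral>\<^sup>+r. ennreal ((indicator {0..t} r * f' r \<omega> - indicator {0..s} r * f r \<omega>)\<^sup>2) \<partial>lborel) \<le> ennreal Q"
  shows "(\<integral>\<^sup>+\<omega>. ennreal (\<bar>I' \<omega> - I \<omega>\<bar> ^ p) \<partial>M) \<le> ennreal (2 * fact p * exp (3 / 2) * sqrt Q ^ p)"
proof -
  define D where "D \<omega> = I' \<omega> - I \<omega>" for \<omega>
  define k where "k = fact p * sqrt Q ^ p"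
  have k: "0 \<le> k" using Q by (simp add: k_def)
  have [measurable]: "D \<in> borel_measurable M"
    unfolding D_def using I1 I2 by (auto simp: has_ito_integral_def)
  have exp_le: "(\<integral>\<^sup>+\<omega>. ennreal (exp (lam * D \<omega>)) \<partial>M) \<le> ennreal (exp (3 / 2))"
    if "lam\<^sup>2 * Q = 1" for lam
  proof -
    have "3 / 2 * lam\<^sup>2 * Q = 3 / 2" using that by simp
    with exp_moment_ito_diff[OF s t I1 I2 less_imp_le[OF Q] bound, of lam] show ?thesis
      unfolding D_def by (simp only:)
  qed
  have "\<bar>D \<omega>\<bar> ^ p \<le> k * (exp (1 / sqrt Q * D \<omega>) + exp (- (1 / sqrt Q) * D \<omega>))" for \<omega>
  proof -
    define y where "y = D \<omega> / sqrt Q"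
    have "\<bar>D \<omega>\<bar> ^ p = sqrt Q ^ p * \<bar>y\<bar> ^ p"
      using Q by (simp add: y_def power_mult_distrib[symmetric] abs_mult)
    also have "\<dots> \<le> sqrt Q ^ p * (fact p * exp \<bar>y\<bar>)"
      using Q by (intro mult_left_mono power_le_fact_exp) auto
    also have "exp \<bar>y\<bar> \<le> exp y + exp (- y)" by (cases "0 \<le> y") auto
    finally show ?thesis using Q by (simp add: y_def k_def mult_ac mult_left_mono)
  qed
  then have "(\<integral>\<^sup>+\<omega>. ennreal (\<bar>D \<omega>\<bar> ^ p) \<partial>M)
      \<le> (\<integral>\<^sup>+\<omega>. ennreal k * (ennreal (exp (1 / sqrt Q * D \<omega>)) + ennreal (exp (- (1 / sqrt Q) * D \<omega>))) \<partial>M)"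
    using k by (intro nn_integral_mono) (simp add: ennreal_mult[symmetric] ennreal_plus[symmetric] del: ennreal_plus)
  also have "\<dots> = ennreal k * ((\<integral>\<^sup>+\<omega>. ennreal (exp (1 / sqrt Q * D \<omega>)) \<partial>M) + (\<integral>\<^sup>+\<omega>. ennreal (exp (- (1 / sqrt Q) * D \<omega>)) \<partial>M))"
    by (subst nn_integral_cmult) (auto simp: nn_integral_add)
  also have "\<dots> \<le> ennreal k * (ennreal (exp (3 / 2)) + ennreal (exp (3 / 2)))"
    using Q by (intro mult_left_mono add_mono exp_le) (auto simp: power_divide)
  also have "\<dots> = ennreal (2 * fact p * exp (3 / 2) * sqrt Q ^ p)"
    using k by (simp add: ennreal_mult[symmetric] ennreal_plus[symmetric] k_def mult_ac del: ennreal_plus)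
  finally show ?thesis by (simp add: D_def)
qed

end

section \<open>Dyadic interpolation and the Kolmogorov criterion\<close>

lemma geometric_increments_limit:
  fixes a :: "nat \<Rightarrow> real"
  assumes inc: "\<And>n. \<bar>a (Suc n) - a n\<bar> \<le> A * \<rho> ^ n" and \<rho>: "0 < \<rho>" "\<rho> < 1"
  shows "\<bar>lim a - a n\<bar> \<le> A / (1 - \<rho>) * \<rho> ^ n"
proof -
  have "summable (\<lambda>n. a (Suc n) - a n)"
  proof (rule summable_comparison_test')
    show "summable (\<lambda>n. A * \<rho> ^ n)"
      using \<rho> by (intro summable_mult summable_geometric) simp
    show "norm (a (Suc n) - a n) \<le> A * \<rho> ^ n" if "0 \<le> n" for n
      using inc by simp
  qed
  then have "convergent (\<lambda>n. \<Sum>i<n. a (Suc i) - a i)"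
    by (simp add: summable_iff_convergent)
  then have "convergent (\<lambda>n. a n - a 0)"
    by (simp add: sum_lessThan_telescope)
  then have conv: "convergent a"
    using convergent_add[OF _ convergent_const[of "a 0"]] by fastforce
  have A: "0 \<le> A" using inc[of 0] by simp
  have tel: "\<bar>a (n + k) - a n\<bar> \<le> A / (1 - \<rho>) * (\<rho> ^ n - \<rho> ^ (n + k))" for k
  proof (induction k)
    case (Suc k)
    have "\<bar>a (n + Suc k) - a n\<bar> \<le> A * \<rho> ^ (n + k) + A / (1 - \<rho>) * (\<rho> ^ n - \<rho> ^ (n + k))"
      using inc[of "n + k"] Suc by auto
    also have "A * \<rho> ^ (n + k) = A / (1 - \<rho>) * (\<rho> ^ (n + k) - \<rho> ^ (n + Suc k))"
      using \<rho> by (simp add: field_simps)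
    finally show ?case by (simp add: algebra_simps)
  qed simp
  have "\<bar>a m - a n\<bar> \<le> A / (1 - \<rho>) * \<rho> ^ n" if "n \<le> m" for m
  proof -
    have "\<bar>a m - a n\<bar> \<le> A / (1 - \<rho>) * (\<rho> ^ n - \<rho> ^ m)"
      using tel[of "m - n"] that by simp
    also have "\<dots> \<le> A / (1 - \<rho>) * \<rho> ^ n"
      using A \<rho> by (intro mult_left_mono) auto
    finally show ?thesis .
  qed
  moreover have "(\<lambda>m. \<bar>a m - a n\<bar>) \<longlonglongrightarrow> \<bar>lim a - a n\<bar>"
    using conv by (intro tendsto_intros) (simp add: convergent_LIMSEQ_iff)
  ultimately show "\<bar>lim a - a n\<bar> \<le> A / (1 - \<rho>) * \<rho> ^ n"
    by (intro LIMSEQ_le_const2) auto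
qed

text \<open>
  The grid is scaled to \<open>T\<close>, so that \<open>0\<close> and \<open>T\<close> are grid points at every level.
\<close>

definition dyadic_floor :: "real \<Rightarrow> nat \<Rightarrow> real \<Rightarrow> real" where
  "dyadic_floor T n t = T * of_int \<lfloor>2 ^ n * t / T\<rfloor> / 2 ^ n"

lemma dyadic_floor_bounds:
  assumes "0 < T"
  shows "dyadic_floor T n t \<le> t" "t < dyadic_floor T n t + T / 2 ^ n"
proof -
  define z where "z = real_of_int \<lfloor>2 ^ n * t / T\<rfloor>"
  have "z \<le> 2 ^ n * t / T" "2 ^ n * t / T < z + 1"
    unfolding z_def by linarith+
  then have "T * z \<le> 2 ^ n * t" "2 ^ n * t < T * (z + 1)"
    using assms by (simp_all add: field_simps)
  then show "dyadic_floor T n t \<le> t" "t < dyadic_floor T n t + T / 2 ^ n"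
    unfolding dyadic_floor_def z_def[symmetric] by (simp_all add: field_simps)
qed

lemma dyadic_floor_nonneg: "0 < T \<Longrightarrow> 0 \<le> t \<Longrightarrow> 0 \<le> dyadic_floor T n t"
  by (simp add: dyadic_floor_def)

lemma dyadic_floor_mem: "0 < T \<Longrightarrow> t \<in> {0..T} \<Longrightarrow> dyadic_floor T n t \<in> {0..T}"
  using dyadic_floor_nonneg[of T t n] dyadic_floor_bounds(1)[of T n t] by auto

lemma dyadic_floor_tendsto:
  assumes "0 < T"
  shows "(\<lambda>n. dyadic_floor T n t) \<longlonglongrightarrow> t"
proof (rule real_tendsto_sandwich)
  show "\<forall>\<^sub>F n in sequentially. t - T * (1 / 2) ^ n \<le> dyadic_floor T n t"
    using dyadic_floor_bounds(2)[OF assms, of t]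
    by (intro always_eventually) (auto simp: power_one_over field_simps less_imp_le)
  show "\<forall>\<^sub>F n in sequentially. dyadic_floor T n t \<le> t"
    using dyadic_floor_bounds(1)[OF assms] by auto
  have "(\<lambda>n. T * (1 / 2) ^ n) \<longlonglongrightarrow> T * 0"
    by (intro tendsto_intros LIMSEQ_realpow_zero) auto
  then show "(\<lambda>n. t - T * (1 / 2) ^ n) \<longlonglongrightarrow> t"
    using tendsto_diff[OF tendsto_const[of t]] by fastforce
qed simp

lemma dyadic_floor_index:
  assumes "0 < T" "t \<in> {0..T}"
  obtains k where "k \<le> 2 ^ n" "\<lfloor>2 ^ n * t / T\<rfloor> = int k" "dyadic_floor T n t = T * real k / 2 ^ n"
proof -
  have "0 \<le> 2 ^ n * t / T" "2 ^ n * t / T \<le> 2 ^ n"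
    using assms by (auto simp: field_simps)
  then have "0 \<le> \<lfloor>2 ^ n * t / T\<rfloor>" "\<lfloor>2 ^ n * t / T\<rfloor> \<le> 2 ^ n"
    by (auto simp: floor_le_iff)
  then show thesis
    by (intro that[of "nat \<lfloor>2 ^ n * t / T\<rfloor>"]) (auto simp: dyadic_floor_def nat_le_iff)
qed

text \<open>
  Passing from level \<open>n\<close> to the next, the dyadic floor of \<open>t\<close> stays or moves by one cell, so the
  values along the floors of \<open>t\<close> converge geometrically. If \<open>|t - s|\<close> is comparable to the mesh of level
  \<open>n\<close>, then the floors of \<open>s\<close> and \<open>t\<close> at that level are equal or adjacent.
\<close>

lemma dyadic_limit_holder:
  fixes x :: "real \<Rightarrow> real"
  assumes T: "0 < T" and \<alpha>: "0 < \<alpha>"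
    and inc: "\<And>n k. k < 2 ^ n \<Longrightarrow>
      \<bar>x (T * real (Suc k) / 2 ^ n) - x (T * real k / 2 ^ n)\<bar> \<le> A * (2 powr - \<alpha>) ^ n"
  shows "holder_on \<alpha> {0..T} (\<lambda>t. lim (\<lambda>n. x (dyadic_floor T n t)))"
proof -
  define \<rho> :: real where "\<rho> = 2 powr - \<alpha>"
  have \<rho>: "0 < \<rho>" "\<rho> < 1"
    using \<alpha> powr_less_mono[of "-\<alpha>" 0 2] by (auto simp: \<rho>_def)
  have A: "0 \<le> A" using inc[of 0 0] by simp
  have step: "\<bar>x (dyadic_floor T (Suc n) t) - x (dyadic_floor T n t)\<bar> \<le> A * \<rho> ^ n"
    if t: "t \<in> {0..T}" for n t
  proof -
    obtain k where k: "\<lfloor>2 ^ n * t / T\<rfloor> = int k" "dyadic_floor T n t = T * real k / 2 ^ n"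
      using dyadic_floor_index[OF T t] by metis
    obtain l where l: "l \<le> 2 ^ Suc n" "\<lfloor>2 ^ Suc n * t / T\<rfloor> = int l"
        "dyadic_floor T (Suc n) t = T * real l / 2 ^ Suc n"
      using dyadic_floor_index[OF T t] by metis
    have "l = 2 * k \<or> l = Suc (2 * k)"
      using k(1) l(2) by (simp add: mult.assoc) linarith
    then show ?thesis
    proof
      assume "l = 2 * k"
      then have "dyadic_floor T (Suc n) t = dyadic_floor T n t"
        using k l by simp
      then show ?thesis using A \<rho> by simp
    next
      assume eq: "l = Suc (2 * k)"
      have "dyadic_floor T n t = T * real (2 * k) / 2 ^ Suc n"
        using k by simp
      moreover have "\<bar>x (T * real (Suc (2 * k)) / 2 ^ Suc n) - x (T * real (2 * k) / 2 ^ Suc n)\<bar>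
          \<le> A * \<rho> ^ Suc n"
        unfolding \<rho>_def using eq l by (intro inc) auto
      moreover have "A * \<rho> ^ Suc n \<le> A * \<rho> ^ n"
        using A \<rho> by (intro mult_left_mono power_decreasing) auto
      ultimately show ?thesis using eq l(3) by simp
    qed
  qed
  define y where "y t = lim (\<lambda>n. x (dyadic_floor T n t))" for t
  have y: "\<bar>y t - x (dyadic_floor T n t)\<bar> \<le> A / (1 - \<rho>) * \<rho> ^ n" if "t \<in> {0..T}" for t n
    unfolding y_def using geometric_increments_limit[OF step[OF that] \<rho>] .
  \<comment> \<open>Two geometric tails and one increment between adjacent floors; \<open>2 / T\<close> converts \<open>t - s\<close> into mesh size.\<close>
  define C where "C = (2 * (A / (1 - \<rho>)) + A) * (2 / T) powr \<alpha>"
  have *: "\<bar>y t - y s\<bar> \<le> C * \<bar>t - s\<bar> powr \<alpha>"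
    if s: "s \<in> {0..T}" and t: "t \<in> {0..T}" and st: "s < t" for s t
  proof -
    have "\<exists>n. T / 2 ^ Suc n < t - s"
    proof -
      obtain n where "T / (t - s) < 2 ^ n"
        using real_arch_pow[of 2 "T / (t - s)"] by auto
      moreover have "(2::real) ^ n \<le> 2 ^ Suc n" by simp
      ultimately have "T / (t - s) < 2 ^ Suc n" by linarith
      then show ?thesis using st by (intro exI[of _ n]) (simp add: field_simps)
    qed
    \<comment> \<open>The level whose mesh satisfies \<open>T / 2\<^bsup>n+1\<^esup> < t - s \<le> T / 2\<^sup>n\<close>.\<close>
    define n where "n = (LEAST n. T / 2 ^ Suc n < t - s)"
    have n1: "T / 2 ^ Suc n < t - s"
      unfolding n_def by (rule LeastI_ex) fact
    have n2: "t - s \<le> T / 2 ^ n"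
    proof (cases n)
      case 0
      then show ?thesis using s t by simp
    next
      case (Suc m)
      then have "\<not> T / 2 ^ Suc m < t - s"
        unfolding n_def by (intro not_less_Least) simp
      then show ?thesis using Suc by simp
    qed
    obtain k where k: "\<lfloor>2 ^ n * s / T\<rfloor> = int k" "dyadic_floor T n s = T * real k / 2 ^ n"
      using dyadic_floor_index[OF T s] by metis
    obtain l where l: "l \<le> 2 ^ n" "\<lfloor>2 ^ n * t / T\<rfloor> = int l"
        "dyadic_floor T n t = T * real l / 2 ^ n"
      using dyadic_floor_index[OF T t] by metis
    have "2 ^ n * s / T \<le> 2 ^ n * t / T" "2 ^ n * t / T \<le> 2 ^ n * s / T + 1"
      using n2 T st by (auto simp: field_simps)
    then have "l = k \<or> l = Suc k"
      using k(1) l(2) by linarith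
    then have mid: "\<bar>x (dyadic_floor T n t) - x (dyadic_floor T n s)\<bar> \<le> A * \<rho> ^ n"
    proof
      assume "l = k"
      then show ?thesis using k l A \<rho> by simp
    next
      assume eq: "l = Suc k"
      then show ?thesis
        unfolding k(2) l(3) \<rho>_def eq using l(1) eq by (intro inc) linarith
    qed
    have "\<bar>y t - y s\<bar> \<le> (2 * (A / (1 - \<rho>)) + A) * \<rho> ^ n"
    proof -
      have "\<bar>y t - y s\<bar> \<le> A / (1 - \<rho>) * \<rho> ^ n + A / (1 - \<rho>) * \<rho> ^ n + A * \<rho> ^ n"
        using y[OF s, of n] y[OF t, of n] mid by linarith
      then show ?thesis by (simp only: ring_distribs mult_2)
    qed
    also have "\<dots> \<le> (2 * (A / (1 - \<rho>)) + A) * (2 / T * (t - s)) powr \<alpha>"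
    proof (rule mult_left_mono)
      have "\<rho> ^ n = (1 / 2 ^ n) powr \<alpha>"
      proof -
        have "1 / 2 ^ n = (2::real) powr - real n"
          by (simp add: powr_minus powr_realpow inverse_eq_divide)
        moreover have "\<rho> ^ n = 2 powr (- \<alpha> * real n)"
          unfolding \<rho>_def by (simp add: powr_realpow[symmetric] powr_powr)
        ultimately show ?thesis by (simp add: powr_powr mult.commute)
      qed
      also have "\<dots> \<le> (2 / T * (t - s)) powr \<alpha>"
        using n1 T \<alpha> by (intro powr_mono2) (auto simp: field_simps)
      finally show "\<rho> ^ n \<le> (2 / T * (t - s)) powr \<alpha>" .
    qed (use A \<rho> in auto)
    also have "(2 / T * (t - s)) powr \<alpha> = (2 / T) powr \<alpha> * \<bar>t - s\<bar> powr \<alpha>"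
      using T st by (subst powr_mult) auto
    finally show ?thesis
      by (simp only: C_def mult.assoc)
  qed
  have "\<bar>y t - y s\<bar> \<le> C * \<bar>t - s\<bar> powr \<alpha>"
    if "s \<in> {0..T}" "t \<in> {0..T}" for s t
    using *[of s t] *[of t s] that
    by (cases s t rule: linorder_cases) (auto simp: abs_minus_commute)
  then show "holder_on \<alpha> {0..T} (\<lambda>t. lim (\<lambda>n. x (dyadic_floor T n t)))"
    unfolding holder_on_def y_def by blast
qed

lemma dyadic_point_mem:
  assumes "0 < T" "k \<le> 2 ^ n"
  shows "T * real k / 2 ^ n \<in> {0..T}"
proof -
  have "real k \<le> 2 ^ n" using assms(2) by (metis of_nat_le_iff of_nat_numeral of_nat_power)
  then show ?thesis using assms(1) by (simp add: field_simps)
qed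

text \<open>
  At level \<open>n\<close> there are \<open>2\<^sup>n\<close> increments, and the \<open>p\<close>-th moment of each, divided by \<open>2\<^bsup>-n\<alpha>p\<^esup>\<close>, is of
  order \<open>2\<^bsup>-n(\<gamma> - \<alpha>)p\<^esup>\<close>. As \<open>(\<gamma> - \<alpha>) p > 1\<close>, the sum of all these moments is finite, so almost surely
  the sum of the normalised powers is finite and bounds each of them.
\<close>

lemma dyadic_increments_AE:
  fixes X :: "real \<Rightarrow> 'a \<Rightarrow> real" and \<gamma> C :: real
  assumes T: "0 < T" and meas: "\<And>t. t \<in> {0..T} \<Longrightarrow> X t \<in> borel_measurable M"
    and p: "1 \<le> p" and gap: "1 < (\<gamma> - \<alpha>) * real p" and C: "0 \<le> C"
    and mom: "\<And>s t. s \<in> {0..T} \<Longrightarrow> t \<in> {0..T} \<Longrightarrow>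
      (\<integral>\<^sup>+\<omega>. ennreal (\<bar>X t \<omega> - X s \<omega>\<bar> ^ p) \<partial>M) \<le> ennreal (C * \<bar>t - s\<bar> powr (\<gamma> * p))"
  shows "AE \<omega> in M. \<exists>A. \<forall>n k. k < 2 ^ n \<longrightarrow>
    \<bar>X (T * real (Suc k) / 2 ^ n) \<omega> - X (T * real k / 2 ^ n) \<omega>\<bar> \<le> A * (2 powr - \<alpha>) ^ n"
proof -
  define \<rho> :: real where "\<rho> = 2 powr - \<alpha>"
  define \<theta> :: real where "\<theta> = 2 powr (1 - (\<gamma> - \<alpha>) * real p)"
  have \<rho>: "0 < \<rho>" by (simp add: \<rho>_def)
  have \<theta>: "0 \<le> \<theta>" "\<theta> < 1"
    using gap powr_less_mono[of "1 - (\<gamma> - \<alpha>) * real p" 0 2] by (auto simp: \<theta>_def)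
  define D where "D n k \<omega> = \<bar>X (T * real (Suc k) / 2 ^ n) \<omega> - X (T * real k / 2 ^ n) \<omega>\<bar>" for n k \<omega>
  have [measurable]: "D n k \<in> borel_measurable M" if "k \<in> {..<2 ^ n}" for n k
    unfolding D_def using that
    by (intro borel_measurable_abs borel_measurable_diff meas dyadic_point_mem T) auto
  have D_int: "(\<integral>\<^sup>+\<omega>. ennreal (D n k \<omega> ^ p) \<partial>M) \<le> ennreal (C * (T / 2 ^ n) powr (\<gamma> * p))"
    if "k < 2 ^ n" for n k
  proof -
    have "\<bar>T * real (Suc k) / 2 ^ n - T * real k / 2 ^ n\<bar> = T / 2 ^ n"
      using T by (simp add: field_simps)
    then show ?thesis
      unfolding D_def
      using mom[OF dyadic_point_mem[OF T, of k n] dyadic_point_mem[OF T, of "Suc k" n]] that by simp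
  qed
  define S where "S n \<omega> = (\<Sum>k<2 ^ n. ennreal ((D n k \<omega> / \<rho> ^ n) ^ p))" for n \<omega>
  have [measurable]: "S n \<in> borel_measurable M" for n
    unfolding S_def by measurable
  have S_int: "(\<integral>\<^sup>+\<omega>. S n \<omega> \<partial>M) \<le> ennreal (C * T powr (\<gamma> * p) * \<theta> ^ n)" for n
  proof -
    have "(\<integral>\<^sup>+\<omega>. S n \<omega> \<partial>M) = (\<Sum>k<2 ^ n. \<integral>\<^sup>+\<omega>. ennreal ((D n k \<omega> / \<rho> ^ n) ^ p) \<partial>M)"
      unfolding S_def by (intro nn_integral_sum) measurable
    also have "\<dots> \<le> (\<Sum>k<(2::nat) ^ n. ennreal (C * (T / 2 ^ n) powr (\<gamma> * p) / (\<rho> ^ n) ^ p))"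
    proof (intro sum_mono)
      fix k :: nat assume k: "k \<in> {..<2 ^ n}"
      have "(\<integral>\<^sup>+\<omega>. ennreal ((D n k \<omega> / \<rho> ^ n) ^ p) \<partial>M)
          = (\<integral>\<^sup>+\<omega>. ennreal (1 / (\<rho> ^ n) ^ p) * ennreal (D n k \<omega> ^ p) \<partial>M)"
        using \<rho> by (intro nn_integral_cong) (simp add: ennreal_mult[symmetric] power_divide D_def)
      also have "\<dots> = ennreal (1 / (\<rho> ^ n) ^ p) * (\<integral>\<^sup>+\<omega>. ennreal (D n k \<omega> ^ p) \<partial>M)"
        using k by (intro nn_integral_cmult) measurable
      also have "\<dots> \<le> ennreal (1 / (\<rho> ^ n) ^ p) * ennreal (C * (T / 2 ^ n) powr (\<gamma> * p))"
        using k by (intro mult_left_mono D_int) auto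
      also have "\<dots> = ennreal (C * (T / 2 ^ n) powr (\<gamma> * p) / (\<rho> ^ n) ^ p)"
        using \<rho> C by (simp add: ennreal_mult[symmetric])
      finally show "(\<integral>\<^sup>+\<omega>. ennreal ((D n k \<omega> / \<rho> ^ n) ^ p) \<partial>M)
        \<le> ennreal (C * (T / 2 ^ n) powr (\<gamma> * p) / (\<rho> ^ n) ^ p)" .
    qed
    also have "\<dots> = ennreal (2 ^ n * (C * (T / 2 ^ n) powr (\<gamma> * p) / (\<rho> ^ n) ^ p))"
    proof -
      have "(2::ennreal) ^ n = ennreal (2 ^ n)" by (simp add: ennreal_power[symmetric])
      then show ?thesis using C \<rho> by (simp add: ennreal_mult[symmetric])
    qed
    also have "2 ^ n * (C * (T / 2 ^ n) powr (\<gamma> * p) / (\<rho> ^ n) ^ p) = C * T powr (\<gamma> * p) * \<theta> ^ n"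
    proof -
      have n2: "(2::real) ^ n = 2 powr real n" by (simp add: powr_realpow)
      have a: "(T / 2 ^ n) powr (\<gamma> * p) = T powr (\<gamma> * p) / 2 powr (real n * (\<gamma> * p))"
        using T unfolding n2 by (simp add: powr_divide powr_powr)
      have b: "(\<rho> ^ n) ^ p = 2 powr (- \<alpha> * (real n * real p))"
        unfolding \<rho>_def power_mult[symmetric]
        by (simp add: powr_realpow[symmetric] powr_powr)
      have c: "\<theta> ^ n = 2 powr ((1 - (\<gamma> - \<alpha>) * real p) * real n)"
        unfolding \<theta>_def by (simp add: powr_realpow[symmetric] powr_powr)
      have "2 powr real n / 2 powr (real n * (\<gamma> * p)) / 2 powr (- \<alpha> * (real n * real p)) = \<theta> ^ n"
        unfolding c by (simp add: powr_diff[symmetric] algebra_simps)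
      then have "C * T powr (\<gamma> * p) * \<theta> ^ n
          = C * T powr (\<gamma> * p) * (2 powr real n / 2 powr (real n * (\<gamma> * p)) / 2 powr (- \<alpha> * (real n * real p)))"
        by (simp only:)
      then show ?thesis
        unfolding a b unfolding n2 by simp
    qed
    finally show ?thesis .
  qed
  have "(\<Sum>n. \<integral>\<^sup>+\<omega>. S n \<omega> \<partial>M) < top"
    using C \<theta> by (intro suminf_ennreal_le_geometric[OF S_int]) auto
  then have "(\<integral>\<^sup>+\<omega>. (\<Sum>n. S n \<omega>) \<partial>M) \<noteq> \<infinity>"
    by (subst nn_integral_suminf) auto
  then have "AE \<omega> in M. (\<Sum>n. S n \<omega>) \<noteq> \<infinity>"
    by (intro nn_integral_noteq_infinite) auto
  then show ?thesis
  proof eventually_elim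
    fix \<omega> assume fin: "(\<Sum>n. S n \<omega>) \<noteq> \<infinity>"
    define A where "A = enn2real (\<Sum>n. S n \<omega>)"
    have A: "(\<Sum>n. S n \<omega>) = ennreal A" "0 \<le> A"
      using fin by (auto simp: A_def less_top)
    \<comment> \<open>A number whose \<open>p\<close>-th power is at most \<open>A\<close> is itself at most \<open>1 + A\<close>, since \<open>p \<ge> 1\<close>.\<close>
    have "D n k \<omega> \<le> (1 + A) * \<rho> ^ n" if k: "k < 2 ^ n" for n k
    proof -
      have nonneg: "0 \<le> D n k \<omega> / \<rho> ^ n" using \<rho> by (simp add: D_def)
      have "ennreal ((D n k \<omega> / \<rho> ^ n) ^ p) \<le> S n \<omega>"
        unfolding S_def using k by (intro member_le_sum) auto
      also have "\<dots> \<le> (\<Sum>n. S n \<omega>)"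
        using sum_le_suminf[of "\<lambda>n. S n \<omega>" "{n}"] by simp
      finally have le: "(D n k \<omega> / \<rho> ^ n) ^ p \<le> A"
        using A by simp
      have "D n k \<omega> / \<rho> ^ n \<le> 1 + A"
      proof (cases "D n k \<omega> / \<rho> ^ n \<le> 1")
        case False
        then show ?thesis using self_le_power[of "D n k \<omega> / \<rho> ^ n" p] p le by simp
      qed (use A in simp)
      then show ?thesis using \<rho> by (simp add: field_simps)
    qed
    then show "\<exists>A. \<forall>n k. k < 2 ^ n \<longrightarrow>
        \<bar>X (T * real (Suc k) / 2 ^ n) \<omega> - X (T * real k / 2 ^ n) \<omega>\<bar> \<le> A * (2 powr - \<alpha>) ^ n"
      unfolding D_def \<rho>_def by blast
  qed
qed

lemma dyadic_floor_limit_AE: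
  fixes X :: "real \<Rightarrow> 'a \<Rightarrow> real" and \<gamma> C :: real
  assumes T: "0 < T" and meas: "\<And>t. t \<in> {0..T} \<Longrightarrow> X t \<in> borel_measurable M"
    and p: "1 \<le> p" and \<gamma>: "0 < \<gamma>" and C: "0 \<le> C"
    and mom: "\<And>s t. s \<in> {0..T} \<Longrightarrow> t \<in> {0..T} \<Longrightarrow>
      (\<integral>\<^sup>+\<omega>. ennreal (\<bar>X t \<omega> - X s \<omega>\<bar> ^ p) \<partial>M) \<le> ennreal (C * \<bar>t - s\<bar> powr (\<gamma> * p))"
    and t: "t \<in> {0..T}"
  shows "AE \<omega> in M. (\<lambda>n. X (dyadic_floor T n t) \<omega>) \<longlonglongrightarrow> X t \<omega>"
proof -
  define u where "u n \<omega> = ennreal (\<bar>X (dyadic_floor T n t) \<omega> - X t \<omega>\<bar> ^ p)" for n \<omega>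
  have [measurable]: "X t \<in> borel_measurable M" "X (dyadic_floor T n t) \<in> borel_measurable M" for n
    using meas dyadic_floor_mem[OF T] t by auto
  have [measurable]: "u n \<in> borel_measurable M" for n
    unfolding u_def by measurable
  define \<theta> :: real where "\<theta> = 2 powr (- (\<gamma> * p))"
  have \<theta>: "0 \<le> \<theta>" "\<theta> < 1"
    using \<gamma> p powr_less_mono[of "- (\<gamma> * p)" 0 2] by (auto simp: \<theta>_def)
  have u_int: "(\<integral>\<^sup>+\<omega>. u n \<omega> \<partial>M) \<le> ennreal (C * T powr (\<gamma> * p) * \<theta> ^ n)" for n
  proof -
    have "(\<integral>\<^sup>+\<omega>. u n \<omega> \<partial>M) \<le> ennreal (C * \<bar>dyadic_floor T n t - t\<bar> powr (\<gamma> * p))"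
      unfolding u_def using t dyadic_floor_mem[OF T t] by (intro mom)
    also have "\<dots> \<le> ennreal (C * (T / 2 ^ n) powr (\<gamma> * p))"
      using dyadic_floor_bounds(1)[OF T, of n t] dyadic_floor_bounds(2)[OF T, of t n] C \<gamma> p
      by (intro ennreal_leI mult_left_mono powr_mono2) auto
    also have "(T / 2 ^ n) powr (\<gamma> * p) = T powr (\<gamma> * p) * \<theta> ^ n"
    proof -
      have "(2::real) ^ n = 2 powr real n" by (simp add: powr_realpow)
      moreover have "\<theta> ^ n = 1 / 2 powr (real n * (\<gamma> * p))"
        unfolding \<theta>_def by (simp add: powr_realpow[symmetric] powr_powr powr_minus field_simps)
      ultimately show ?thesis using T by (simp add: powr_divide powr_powr)
    qed
    finally show ?thesis by (simp add: mult.assoc)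
  qed
  have "(\<Sum>n. \<integral>\<^sup>+\<omega>. u n \<omega> \<partial>M) < top"
    using C \<theta> by (intro suminf_ennreal_le_geometric[OF u_int]) auto
  then have "AE \<omega> in M. (\<lambda>n. u n \<omega>) \<longlonglongrightarrow> 0"
    by (intro AE_tendsto_0_if_suminf_nn_integral) auto
  then show ?thesis
  proof eventually_elim
    fix \<omega> assume "(\<lambda>n. u n \<omega>) \<longlonglongrightarrow> 0"
    then have "(\<lambda>n. \<bar>X (dyadic_floor T n t) \<omega> - X t \<omega>\<bar> ^ p) \<longlonglongrightarrow> 0"
      unfolding u_def by (simp add: ennreal_tendsto_0_iff)
    from tendsto_real_root[OF this, of p]
    have "(\<lambda>n. \<bar>X (dyadic_floor T n t) \<omega> - X t \<omega>\<bar>) \<longlonglongrightarrow> 0"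
      using p by (simp add: real_root_power_cancel)
    then have "(\<lambda>n. X (dyadic_floor T n t) \<omega> - X t \<omega>) \<longlonglongrightarrow> 0"
      by (simp add: tendsto_rabs_zero_iff)
    then show "(\<lambda>n. X (dyadic_floor T n t) \<omega>) \<longlonglongrightarrow> X t \<omega>"
      by (rule LIM_zero_cancel)
  qed
qed

lemma holder_on_mono:
  assumes "holder_on \<beta> {0..T} f" "\<alpha> \<le> \<beta>"
  shows "holder_on \<alpha> {0..T} f"
proof -
  obtain C where C: "\<And>s t. s \<in> {0..T} \<Longrightarrow> t \<in> {0..T} \<Longrightarrow> \<bar>f t - f s\<bar> \<le> C * \<bar>t - s\<bar> powr \<beta>"
    using assms(1) unfolding holder_on_def by blast
  have "\<bar>f t - f s\<bar> \<le> (\<bar>C\<bar> * T powr (\<beta> - \<alpha>)) * \<bar>t - s\<bar> powr \<alpha>" if "s \<in> {0..T}" "t \<in> {0..T}" for s t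
  proof -
    have "\<bar>f t - f s\<bar> \<le> C * \<bar>t - s\<bar> powr \<beta>" by (rule C) fact+
    also have "\<dots> \<le> \<bar>C\<bar> * \<bar>t - s\<bar> powr \<beta>" by (intro mult_right_mono) auto
    also have "\<bar>t - s\<bar> powr \<beta> = \<bar>t - s\<bar> powr (\<beta> - \<alpha>) * \<bar>t - s\<bar> powr \<alpha>"
      by (simp add: powr_add[symmetric])
    also have "\<bar>C\<bar> * \<dots> \<le> \<bar>C\<bar> * (T powr (\<beta> - \<alpha>) * \<bar>t - s\<bar> powr \<alpha>)"
      using that assms(2) by (intro mult_left_mono mult_right_mono powr_mono2) auto
    finally show ?thesis by (simp add: mult.assoc)
  qed
  then show ?thesis unfolding holder_on_def by blast
qed

text \<open>
  On paths and at times where the limit does not exist, \<open>lim\<close> has some unspecified value; this does not affect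
  measurability.
\<close>

definition dyadic_limit :: "real \<Rightarrow> (real \<Rightarrow> 'a \<Rightarrow> real) \<Rightarrow> real \<Rightarrow> 'a \<Rightarrow> real" where
  "dyadic_limit T X t \<omega> = lim (\<lambda>n. X (dyadic_floor T n t) \<omega>)"

lemma dyadic_limit_measurable:
  assumes T: "0 < T" and X: "measurable_process M T X"
  shows "measurable_process M T (dyadic_limit T X)"
proof -
  let ?R = "restrict_space borel {0..T} :: real measure"
  have X': "(\<lambda>(t, \<omega>). X t \<omega>) \<in> borel_measurable (?R \<Otimes>\<^sub>M M)"
    using X by (simp add: measurable_process_def)
  have "(\<lambda>(t, \<omega>). X (dyadic_floor T n t) \<omega>) \<in> borel_measurable (?R \<Otimes>\<^sub>M M)" for n
  proof -
    have "dyadic_floor T n \<in> borel_measurable borel"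
      unfolding dyadic_floor_def by measurable
    then have "dyadic_floor T n \<in> measurable ?R ?R"
      using dyadic_floor_mem[OF T] by (intro measurable_restrict_space3) auto
    then have "(\<lambda>x. (dyadic_floor T n (fst x), snd x)) \<in> measurable (?R \<Otimes>\<^sub>M M) (?R \<Otimes>\<^sub>M M)"
      by measurable
    from measurable_compose[OF this X'] show ?thesis
      by (simp add: case_prod_beta')
  qed
  then have "(\<lambda>x. lim (\<lambda>n. (\<lambda>(t, \<omega>). X (dyadic_floor T n t) \<omega>) x)) \<in> borel_measurable (?R \<Otimes>\<^sub>M M)"
    by (rule borel_measurable_lim_metric)
  then show ?thesis
    by (simp add: measurable_process_def dyadic_limit_def case_prod_beta')
qed

text \<open>
  The dyadic floor of \<open>t\<close> never exceeds \<open>t\<close>.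
\<close>

lemma dyadic_limit_adapted:
  assumes T: "0 < T" and F: "filtration_on M T F" and X: "adapted_process F T X"
  shows "adapted_process F T (dyadic_limit T X)"
  unfolding adapted_process_def
proof
  fix t assume t: "t \<in> {0..T}"
  have "X (dyadic_floor T n t) \<in> borel_measurable (F t)" for n
  proof -
    have d: "dyadic_floor T n t \<in> {0..T}" "dyadic_floor T n t \<le> t"
      using dyadic_floor_mem[OF T t] dyadic_floor_bounds(1)[OF T] by auto
    then have "X (dyadic_floor T n t) \<in> borel_measurable (F (dyadic_floor T n t))"
      using X by (auto simp: adapted_process_def)
    moreover have "subalgebra (F t) (F (dyadic_floor T n t))"
      using F d t by (auto simp: filtration_on_def subalgebra_def)
    ultimately show ?thesis by (rule measurable_from_subalg[rotated])
  qed
  then show "dyadic_limit T X t \<in> borel_measurable (F t)"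
    unfolding dyadic_limit_def by (rule borel_measurable_lim_metric)
qed

lemma dyadic_limit_eq_if_continuous:
  assumes T: "0 < T" and cont: "continuous_on {0..T} (\<lambda>t. X t \<omega>)" and t: "t \<in> {0..T}"
  shows "dyadic_limit T X t \<omega> = X t \<omega>"
proof -
  have "(\<lambda>n. X (dyadic_floor T n t) \<omega>) \<longlonglongrightarrow> X t \<omega>"
    using continuous_on_tendsto_compose[OF cont dyadic_floor_tendsto[OF T] t]
      dyadic_floor_mem[OF T t] by simp
  then show ?thesis unfolding dyadic_limit_def by (rule limI)
qed

text \<open>
  Moments of all orders with exponents \<open>\<gamma> p\<close>, for every \<open>\<gamma> < \<kappa>\<close>, give every Hoelder exponent below \<open>\<kappa>\<close>:
  for given \<open>\<alpha> < \<gamma>\<close> choose \<open>p\<close> with \<open>(\<gamma> - \<alpha>) p > 1\<close>. A sequence of exponents increasing to \<open>\<kappa>\<close>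
  suffices, so a single null set serves all exponents.
\<close>

lemma kolmogorov_holder_modification:
  fixes X :: "real \<Rightarrow> 'a \<Rightarrow> real"
  assumes T: "0 < T" and meas: "\<And>t. t \<in> {0..T} \<Longrightarrow> X t \<in> borel_measurable M" and \<kappa>: "0 < \<kappa>"
    and mom: "\<And>\<gamma> p. 0 < \<gamma> \<Longrightarrow> \<gamma> < \<kappa> \<Longrightarrow> 2 \<le> p \<Longrightarrow> \<exists>C\<ge>0. \<forall>s\<in>{0..T}. \<forall>t\<in>{0..T}.
      (\<integral>\<^sup>+\<omega>. ennreal (\<bar>X t \<omega> - X s \<omega>\<bar> ^ p) \<partial>M) \<le> ennreal (C * \<bar>t - s\<bar> powr (\<gamma> * real p))"
  shows "modification_of M T X (dyadic_limit T X)"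
    and "AE \<omega> in M. \<forall>\<alpha>\<in>{0<..<\<kappa>}. holder_on \<alpha> {0..T} (\<lambda>t. dyadic_limit T X t \<omega>)"
proof -
  \<comment> \<open>Any order and exponent would do here: they only have to give convergence at a fixed time.\<close>
  obtain C where C: "0 \<le> C" "\<And>s t. s \<in> {0..T} \<Longrightarrow> t \<in> {0..T} \<Longrightarrow>
      (\<integral>\<^sup>+\<omega>. ennreal (\<bar>X t \<omega> - X s \<omega>\<bar> ^ 2) \<partial>M) \<le> ennreal (C * \<bar>t - s\<bar> powr (\<kappa> / 2 * real 2))"
    using mom[of "\<kappa> / 2" 2] \<kappa> by auto
  show "modification_of M T X (dyadic_limit T X)"
    unfolding modification_of_def
  proof
    fix t assume t: "t \<in> {0..T}"
    have "AE \<omega> in M. (\<lambda>n. X (dyadic_floor T n t) \<omega>) \<longlonglongrightarrow> X t \<omega>"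
      by (rule dyadic_floor_limit_AE[OF T meas _ _ C t]) (use \<kappa> in auto)
    then show "AE \<omega> in M. dyadic_limit T X t \<omega> = X t \<omega>"
      unfolding dyadic_limit_def by eventually_elim (rule limI)
  qed
  have *: "AE \<omega> in M. holder_on \<alpha> {0..T} (\<lambda>t. dyadic_limit T X t \<omega>)" if \<alpha>: "0 < \<alpha>" "\<alpha> < \<kappa>" for \<alpha>
  proof -
    define \<gamma> where "\<gamma> = (\<alpha> + \<kappa>) / 2"
    have \<gamma>: "0 < \<gamma>" "\<gamma> < \<kappa>" "\<alpha> < \<gamma>" using \<alpha> by (auto simp: \<gamma>_def)
    obtain m :: nat where m: "1 / (\<gamma> - \<alpha>) < real m" using reals_Archimedean2 by blast
    define p where "p = m + 2"
    have gap: "1 < (\<gamma> - \<alpha>) * real p"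
    proof -
      have "1 = (\<gamma> - \<alpha>) * (1 / (\<gamma> - \<alpha>))" using \<gamma> by simp
      also have "\<dots> < (\<gamma> - \<alpha>) * real p" using \<gamma> m by (intro mult_strict_left_mono) (auto simp: p_def)
      finally show ?thesis .
    qed
    obtain C where C: "0 \<le> C" "\<And>s t. s \<in> {0..T} \<Longrightarrow> t \<in> {0..T} \<Longrightarrow>
        (\<integral>\<^sup>+\<omega>. ennreal (\<bar>X t \<omega> - X s \<omega>\<bar> ^ p) \<partial>M) \<le> ennreal (C * \<bar>t - s\<bar> powr (\<gamma> * real p))"
      using mom[of \<gamma> p] \<gamma> by (auto simp: p_def)
    have "AE \<omega> in M. \<exists>A. \<forall>n k. k < 2 ^ n \<longrightarrow>
        \<bar>X (T * real (Suc k) / 2 ^ n) \<omega> - X (T * real k / 2 ^ n) \<omega>\<bar> \<le> A * (2 powr - \<alpha>) ^ n"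
      by (rule dyadic_increments_AE[OF T meas _ gap C]) (auto simp: p_def)
    then show ?thesis
    proof eventually_elim
      case (elim \<omega>)
      then obtain A where "\<And>n k. k < 2 ^ n \<Longrightarrow>
          \<bar>X (T * real (Suc k) / 2 ^ n) \<omega> - X (T * real k / 2 ^ n) \<omega>\<bar> \<le> A * (2 powr - \<alpha>) ^ n"
        by blast
      then show ?case
        unfolding dyadic_limit_def by (rule dyadic_limit_holder[OF T \<alpha>(1)])
    qed
  qed
  have "AE \<omega> in M. \<forall>m::nat. holder_on (\<kappa> * (1 - 1 / (real m + 2))) {0..T} (\<lambda>t. dyadic_limit T X t \<omega>)"
    unfolding AE_all_countable
  proof
    fix m :: nat
    have "0 < 1 - 1 / (real m + 2)" "1 - 1 / (real m + 2) < 1" by (auto simp: field_simps)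
    then have "0 < \<kappa> * (1 - 1 / (real m + 2))" "\<kappa> * (1 - 1 / (real m + 2)) < \<kappa> * 1"
      using \<kappa> by (auto intro!: mult_pos_pos mult_strict_left_mono)
    then show "AE \<omega> in M. holder_on (\<kappa> * (1 - 1 / (real m + 2))) {0..T} (\<lambda>t. dyadic_limit T X t \<omega>)"
      by (intro *) simp_all
  qed
  then show "AE \<omega> in M. \<forall>\<alpha>\<in>{0<..<\<kappa>}. holder_on \<alpha> {0..T} (\<lambda>t. dyadic_limit T X t \<omega>)"
  proof eventually_elim
    fix \<omega> assume H: "\<forall>m::nat. holder_on (\<kappa> * (1 - 1 / (real m + 2))) {0..T} (\<lambda>t. dyadic_limit T X t \<omega>)"
    show "\<forall>\<alpha>\<in>{0<..<\<kappa>}. holder_on \<alpha> {0..T} (\<lambda>t. dyadic_limit T X t \<omega>)"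
    proof
      fix \<alpha> assume \<alpha>: "\<alpha> \<in> {0<..<\<kappa>}"
      obtain m :: nat where m: "\<kappa> / (\<kappa> - \<alpha>) < real m" using reals_Archimedean2 by blast
      have "\<alpha> \<le> \<kappa> * (1 - 1 / (real m + 2))"
      proof -
        have "\<kappa> < real m * (\<kappa> - \<alpha>)" using m \<alpha> by (simp add: field_simps)
        also have "\<dots> \<le> (real m + 2) * (\<kappa> - \<alpha>)" using \<alpha> by (intro mult_right_mono) auto
        finally have "\<kappa> / (real m + 2) \<le> \<kappa> - \<alpha>" by (simp add: field_simps)
        then show ?thesis by (simp add: right_diff_distrib)
      qed
      then show "holder_on \<alpha> {0..T} (\<lambda>t. dyadic_limit T X t \<omega>)"
        using H holder_on_mono by blast
    qed
  qed
qed

section \<open>Self-exciting multifractional processes\<close>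

lemma power_add_le:
  fixes a b :: real
  assumes "0 \<le> a" "0 \<le> b"
  shows "(a + b) ^ p \<le> 2 ^ p * (a ^ p + b ^ p)"
proof -
  have "(a + b) ^ p \<le> (2 * max a b) ^ p" using assms by (intro power_mono) auto
  also have "\<dots> = 2 ^ p * max a b ^ p" by (rule power_mult_distrib)
  also have "max a b ^ p \<le> a ^ p + b ^ p" using assms by (simp add: max_def)
  finally show ?thesis by simp
qed

lemma powr_exponent_le:
  fixes d T \<theta> a :: real
  assumes "0 \<le> d" "d \<le> T" "\<theta> \<le> a"
  shows "d powr a \<le> T powr (a - \<theta>) * d powr \<theta>"
proof -
  have "d powr a = d powr (a - \<theta>) * d powr \<theta>" by (simp add: powr_add[symmetric])
  also have "\<dots> \<le> T powr (a - \<theta>) * d powr \<theta>"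
    using assms by (intro mult_right_mono powr_mono2) auto
  finally show ?thesis .
qed

context filtered_brownian_motion
begin

lemma ito_integral_increment_moment:
  assumes T: "0 < T" and h: "hurst_function T lo up h"
    and I: "\<And>t. t \<in> {0..T} \<Longrightarrow> has_ito_integral M F B t (\<lambda>s \<omega>. (t - s) powr (h t (X s \<omega>) - 1/2)) (I t)"
    and \<gamma>: "0 < \<gamma>" "lo - 1 / 2 \<le> \<gamma>" "\<gamma> < lo"
  obtains C where "0 \<le> C" "\<And>s t. 0 \<le> s \<Longrightarrow> s < t \<Longrightarrow> t \<le> T \<Longrightarrow>
    (\<integral>\<^sup>+\<omega>. ennreal (\<bar>I t \<omega> - I s \<omega>\<bar> ^ p) \<partial>M) \<le> ennreal (C * (t - s) powr (\<gamma> * p))"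
proof -
  obtain K where K: "0 < K" "\<And>s t x. 0 \<le> s \<Longrightarrow> s < t \<Longrightarrow> t \<le> T \<Longrightarrow>
      (\<integral>\<^sup>+r. ennreal ((indicator {0..t} r * (t - r) powr (h t (x r) - 1 / 2)
        - indicator {0..s} r * (s - r) powr (h s (x r) - 1 / 2))\<^sup>2) \<partial>lborel)
      \<le> ennreal (K * (t - s) powr (2 * \<gamma>))"
    using kernel_difference_integral_bound[OF T h \<gamma>] by blast
  show thesis
  proof (rule that[of "2 * fact p * exp (3 / 2) * sqrt K ^ p"])
    show "0 \<le> 2 * fact p * exp (3 / 2) * sqrt K ^ p" using K by simp
    fix s t :: real assume st: "0 \<le> s" "s < t" "t \<le> T"
    then have "s \<in> {0..T}" "t \<in> {0..T}" by auto
    then have "(\<integral>\<^sup>+\<omega>. ennreal (\<bar>I t \<omega> - I s \<omega>\<bar> ^ p) \<partial>M)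
        \<le> ennreal (2 * fact p * exp (3 / 2) * sqrt (K * (t - s) powr (2 * \<gamma>)) ^ p)"
      using K(1) st K(2)[OF st] by (intro moment_ito_diff[OF _ _ I I]) auto
    also have "sqrt (K * (t - s) powr (2 * \<gamma>)) ^ p = sqrt K ^ p * (t - s) powr (\<gamma> * p)"
    proof -
      have "sqrt ((t - s) powr (2 * \<gamma>)) = (t - s) powr \<gamma>"
        by (intro real_sqrt_unique) (auto simp: power2_eq_square powr_add[symmetric])
      then show ?thesis
        using st by (simp add: real_sqrt_mult power_mult_distrib powr_realpow[symmetric] powr_powr)
    qed
    finally show "(\<integral>\<^sup>+\<omega>. ennreal (\<bar>I t \<omega> - I s \<omega>\<bar> ^ p) \<partial>M)
        \<le> ennreal (2 * fact p * exp (3 / 2) * sqrt K ^ p * (t - s) powr (\<gamma> * p))"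
      by (simp add: mult.assoc)
  qed
qed

text \<open>
  The kernel estimate is available for \<open>\<gamma> \<ge> lo - 1/2\<close> only; the exponent \<open>\<theta>\<close> is reached by applying
  it with \<open>\<gamma> = max \<theta> (lo - 1/2) < lo\<close> and using that \<open>|t - s|\<close> is bounded by \<open>T\<close>.
\<close>

lemma sem_increment_moment:
  fixes p :: nat
  assumes T: "0 < T" and h: "hurst_function T lo up h" and sem: "sem_process M F T B h g X"
    and g: "adapted_process F T g"
    and gmom: "\<And>p::real. p \<ge> 2 \<Longrightarrow> \<exists>C::real. \<forall>s\<in>{0..T}. \<forall>t\<in>{0..T}.
      (\<integral>\<^sup>+\<omega>. ennreal (\<bar>g t \<omega> - g s \<omega>\<bar> powr p) \<partial>M) \<le> ennreal (C * \<bar>t - s\<bar> powr (\<delta> * p))"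
    and \<theta>: "0 < \<theta>" "\<theta> < min lo \<delta>" and p: "2 \<le> p"
  shows "\<exists>C\<ge>0. \<forall>s\<in>{0..T}. \<forall>t\<in>{0..T}.
      (\<integral>\<^sup>+\<omega>. ennreal (\<bar>X t \<omega> - X s \<omega>\<bar> ^ p) \<partial>M) \<le> ennreal (C * \<bar>t - s\<bar> powr (\<theta> * p))"
proof -
  define I where "I t \<omega> = X t \<omega> - g t \<omega>" for t \<omega>
  have ito: "has_ito_integral M F B t (\<lambda>s \<omega>. (t - s) powr (h t (X s \<omega>) - 1/2)) (I t)" if "t \<in> {0..T}" for t
    using sem that unfolding sem_process_def I_def by blast
  have meas: "I t \<in> borel_measurable M" "g t \<in> borel_measurable M" if "t \<in> {0..T}" for t
    using ito[OF that] g that measurable_from_filtration[of "g t" t]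
    by (auto simp: has_ito_integral_def adapted_process_def)
  define \<gamma> where "\<gamma> = max \<theta> (lo - 1 / 2)"
  have \<gamma>: "0 < \<gamma>" "lo - 1 / 2 \<le> \<gamma>" "\<gamma> < lo" "\<theta> \<le> \<gamma>" using \<theta> by (auto simp: \<gamma>_def)
  obtain C1 where C1: "0 \<le> C1" "\<And>s t. 0 \<le> s \<Longrightarrow> s < t \<Longrightarrow> t \<le> T \<Longrightarrow>
      (\<integral>\<^sup>+\<omega>. ennreal (\<bar>I t \<omega> - I s \<omega>\<bar> ^ p) \<partial>M) \<le> ennreal (C1 * (t - s) powr (\<gamma> * p))"
    using ito_integral_increment_moment[OF T h ito \<gamma>(1-3)] by blast
  have "\<exists>C2. \<forall>s\<in>{0..T}. \<forall>t\<in>{0..T}. (\<integral>\<^sup>+\<omega>. ennreal (\<bar>g t \<omega> - g s \<omega>\<bar> powr real p) \<partial>M)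
      \<le> ennreal (C2 * \<bar>t - s\<bar> powr (\<delta> * real p))"
    using p by (intro gmom) simp
  then obtain C2 where C2: "\<And>s t. s \<in> {0..T} \<Longrightarrow> t \<in> {0..T} \<Longrightarrow>
      (\<integral>\<^sup>+\<omega>. ennreal (\<bar>g t \<omega> - g s \<omega>\<bar> powr real p) \<partial>M) \<le> ennreal (C2 * \<bar>t - s\<bar> powr (\<delta> * real p))"
    by blast
  define C where "C = 2 ^ p * (C1 * T powr (\<gamma> * p - \<theta> * p) + \<bar>C2\<bar> * T powr (\<delta> * p - \<theta> * p))"
  have C: "0 \<le> C" using C1 by (simp add: C_def)
  have *: "(\<integral>\<^sup>+\<omega>. ennreal (\<bar>X t \<omega> - X s \<omega>\<bar> ^ p) \<partial>M) \<le> ennreal (C * (t - s) powr (\<theta> * p))"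
    if st: "0 \<le> s" "s < t" "t \<le> T" for s t
  proof -
    have sT: "s \<in> {0..T}" and tT: "t \<in> {0..T}" using st by auto
    note [measurable] = meas[OF sT] meas[OF tT]
    have "\<bar>X t \<omega> - X s \<omega>\<bar> ^ p \<le> 2 ^ p * (\<bar>I t \<omega> - I s \<omega>\<bar> ^ p + \<bar>g t \<omega> - g s \<omega>\<bar> powr real p)" for \<omega>
    proof -
      have "\<bar>X t \<omega> - X s \<omega>\<bar> ^ p \<le> (\<bar>I t \<omega> - I s \<omega>\<bar> + \<bar>g t \<omega> - g s \<omega>\<bar>) ^ p"
        by (intro power_mono) (auto simp: I_def)
      also have "\<dots> \<le> 2 ^ p * (\<bar>I t \<omega> - I s \<omega>\<bar> ^ p + \<bar>g t \<omega> - g s \<omega>\<bar> ^ p)"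
        by (rule power_add_le) auto
      also have "\<bar>g t \<omega> - g s \<omega>\<bar> ^ p = \<bar>g t \<omega> - g s \<omega>\<bar> powr real p"
        using p by (subst powr_realpow') auto
      finally show ?thesis .
    qed
    then have "(\<integral>\<^sup>+\<omega>. ennreal (\<bar>X t \<omega> - X s \<omega>\<bar> ^ p) \<partial>M)
        \<le> (\<integral>\<^sup>+\<omega>. ennreal (2 ^ p) * (ennreal (\<bar>I t \<omega> - I s \<omega>\<bar> ^ p) + ennreal (\<bar>g t \<omega> - g s \<omega>\<bar> powr real p)) \<partial>M)"
      by (intro nn_integral_mono) (simp add: ennreal_mult[symmetric] ennreal_plus[symmetric] del: ennreal_plus)
    also have "\<dots> = ennreal (2 ^ p) * ((\<integral>\<^sup>+\<omega>. ennreal (\<bar>I t \<omega> - I s \<omega>\<bar> ^ p) \<partial>M)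
        + (\<integral>\<^sup>+\<omega>. ennreal (\<bar>g t \<omega> - g s \<omega>\<bar> powr real p) \<partial>M))"
      by (subst nn_integral_cmult) (auto simp: nn_integral_add)
    also have "\<dots> \<le> ennreal (2 ^ p) * (ennreal (C1 * T powr (\<gamma> * p - \<theta> * p) * (t - s) powr (\<theta> * p))
        + ennreal (\<bar>C2\<bar> * T powr (\<delta> * p - \<theta> * p) * (t - s) powr (\<theta> * p)))"
    proof (intro mult_left_mono add_mono)
      have "(\<integral>\<^sup>+\<omega>. ennreal (\<bar>I t \<omega> - I s \<omega>\<bar> ^ p) \<partial>M) \<le> ennreal (C1 * (t - s) powr (\<gamma> * p))"
        by (rule C1) fact+
      also have "\<dots> \<le> ennreal (C1 * (T powr (\<gamma> * p - \<theta> * p) * (t - s) powr (\<theta> * p)))"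
        using C1 st \<gamma> by (intro ennreal_leI mult_left_mono powr_exponent_le mult_right_mono) auto
      finally show "(\<integral>\<^sup>+\<omega>. ennreal (\<bar>I t \<omega> - I s \<omega>\<bar> ^ p) \<partial>M)
        \<le> ennreal (C1 * T powr (\<gamma> * p - \<theta> * p) * (t - s) powr (\<theta> * p))" by (simp add: mult.assoc)
      have "(\<integral>\<^sup>+\<omega>. ennreal (\<bar>g t \<omega> - g s \<omega>\<bar> powr real p) \<partial>M) \<le> ennreal (C2 * \<bar>t - s\<bar> powr (\<delta> * real p))"
        by (rule C2) fact+
      also have "\<dots> \<le> ennreal (\<bar>C2\<bar> * \<bar>t - s\<bar> powr (\<delta> * p))"
        by (intro ennreal_leI mult_right_mono) auto
      also have "\<dots> \<le> ennreal (\<bar>C2\<bar> * (T powr (\<delta> * p - \<theta> * p) * (t - s) powr (\<theta> * p)))"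
        using st \<theta> powr_exponent_le[of "t - s" T "\<theta> * p" "\<delta> * p"] mult_right_mono[of \<theta> \<delta> "real p"]
        by (intro ennreal_leI mult_left_mono) (auto intro: mult_right_mono)
      finally show "(\<integral>\<^sup>+\<omega>. ennreal (\<bar>g t \<omega> - g s \<omega>\<bar> powr real p) \<partial>M)
        \<le> ennreal (\<bar>C2\<bar> * T powr (\<delta> * p - \<theta> * p) * (t - s) powr (\<theta> * p))" by (simp add: mult.assoc)
    qed auto
    also have "\<dots> = ennreal (C * (t - s) powr (\<theta> * p))"
      using C1 by (simp add: C_def ennreal_mult[symmetric] ennreal_plus[symmetric] algebra_simps del: ennreal_plus)
    finally show ?thesis .
  qed
  have "(\<integral>\<^sup>+\<omega>. ennreal (\<bar>X t \<omega> - X s \<omega>\<bar> ^ p) \<partial>M) \<le> ennreal (C * \<bar>t - s\<bar> powr (\<theta> * p))"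
    if "s \<in> {0..T}" "t \<in> {0..T}" for s t
  proof (cases s t rule: linorder_cases)
    case less
    then show ?thesis using *[of s t] that by simp
  next
    case equal
    then show ?thesis using p by simp
  next
    case greater
    then show ?thesis using *[of t s] that by (simp add: abs_minus_commute)
  qed
  then show ?thesis using C by blast
qed

text \<open>
  By Tonelli's theorem, integrands that agree almost surely at each time have the same \<open>L\<^sup>2\<close> distance to
  every elementary process, so the same approximating sequence works.
\<close>

lemma has_ito_integral_cong_AE:
  assumes I: "has_ito_integral M F B t f I" and t: "t \<in> {0..T}"
    and f': "measurable_process M t f'" "adapted_process F t f'"
    and I': "I' \<in> borel_measurable M"
    and eq_f: "\<And>s. s \<in> {0..t} \<Longrightarrow> AE \<omega> in M. f' s \<omega> = f s \<omega>"
    and eq_I: "AE \<omega> in M. I' \<omega> = I \<omega>"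
  shows "has_ito_integral M F B t f' I'"
proof -
  obtain n p \<xi> where el: "\<And>k. elementary_data F t (n k) (p k) (\<xi> k)"
    and lim: "(\<lambda>k. \<integral>\<^sup>+\<omega>. (\<integral>\<^sup>+s\<in>{0..t}.
               ennreal ((f s \<omega> - elementary_process (n k) (p k) (\<xi> k) s \<omega>)\<^sup>2) \<partial>lborel) \<partial>M) \<longlonglongrightarrow> 0"
      "(\<lambda>k. \<integral>\<^sup>+\<omega>. ennreal ((I \<omega> - elementary_integral B (n k) (p k) (\<xi> k) \<omega>)\<^sup>2) \<partial>M) \<longlonglongrightarrow> 0"
    and f: "measurable_process M t f"
    using I unfolding has_ito_integral_def by blast
  interpret pair_sigma_finite M lborel ..
  have T: "0 \<le> t" "t \<le> T" using t by auto
  have swap: "(\<integral>\<^sup>+\<omega>. (\<integral>\<^sup>+s\<in>{0..t}. ennreal ((f s \<omega> - elementary_process (n k) (p k) (\<xi> k) s \<omega>)\<^sup>2) \<partial>lborel) \<partial>M)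
      = (\<integral>\<^sup>+s. (\<integral>\<^sup>+\<omega>. ennreal ((f s \<omega> - elementary_process (n k) (p k) (\<xi> k) s \<omega>)\<^sup>2) * indicator {0..t} s \<partial>M) \<partial>lborel)"
    if "measurable_process M t f" for f k
  proof -
    have [measurable]: "(\<lambda>(\<omega>, r). elementary_process (n k) (p k) (\<xi> k) r \<omega>) \<in> borel_measurable (M \<Otimes>\<^sub>M borel)"
        "(\<lambda>(\<omega>, r). indicator {0..t} r * f r \<omega>) \<in> borel_measurable (M \<Otimes>\<^sub>M borel)"
      using elementary_process_measurable[OF el T(2)] process_measurable_extend[OF that T(1)] by auto
    have "(\<lambda>(\<omega>, s). ennreal ((indicator {0..t} s * f s \<omega> - elementary_process (n k) (p k) (\<xi> k) s \<omega>)\<^sup>2)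
        * indicator {0..t} s) \<in> borel_measurable (M \<Otimes>\<^sub>M borel)"
      by measurable
    also have "(\<lambda>(\<omega>, s). ennreal ((indicator {0..t} s * f s \<omega> - elementary_process (n k) (p k) (\<xi> k) s \<omega>)\<^sup>2)
        * indicator {0..t} s)
      = (\<lambda>(\<omega>, s). ennreal ((f s \<omega> - elementary_process (n k) (p k) (\<xi> k) s \<omega>)\<^sup>2) * indicator {0..t} s)"
      by (auto simp: fun_eq_iff indicator_def)
    finally show ?thesis
      by (intro Fubini'[symmetric]) (simp cong: measurable_cong_sets sets_pair_measure_cong)
  qed
  have "(\<integral>\<^sup>+\<omega>. (\<integral>\<^sup>+s\<in>{0..t}. ennreal ((f' s \<omega> - elementary_process (n k) (p k) (\<xi> k) s \<omega>)\<^sup>2) \<partial>lborel) \<partial>M)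
      = (\<integral>\<^sup>+\<omega>. (\<integral>\<^sup>+s\<in>{0..t}. ennreal ((f s \<omega> - elementary_process (n k) (p k) (\<xi> k) s \<omega>)\<^sup>2) \<partial>lborel) \<partial>M)" for k
    unfolding swap[OF f'(1)] swap[OF f]
  proof (rule nn_integral_cong)
    fix s
    show "(\<integral>\<^sup>+\<omega>. ennreal ((f' s \<omega> - elementary_process (n k) (p k) (\<xi> k) s \<omega>)\<^sup>2) * indicator {0..t} s \<partial>M)
        = (\<integral>\<^sup>+\<omega>. ennreal ((f s \<omega> - elementary_process (n k) (p k) (\<xi> k) s \<omega>)\<^sup>2) * indicator {0..t} s \<partial>M)"
    proof (cases "s \<in> {0..t}")
      case True
      then show ?thesis
        using eq_f[OF True] by (auto intro!: nn_integral_cong_AE elim!: eventually_mono)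
    qed simp
  qed
  moreover have "(\<integral>\<^sup>+\<omega>. ennreal ((I' \<omega> - elementary_integral B (n k) (p k) (\<xi> k) \<omega>)\<^sup>2) \<partial>M)
      = (\<integral>\<^sup>+\<omega>. ennreal ((I \<omega> - elementary_integral B (n k) (p k) (\<xi> k) \<omega>)\<^sup>2) \<partial>M)" for k
    using eq_I by (auto intro!: nn_integral_cong_AE elim!: eventually_mono)
  ultimately show ?thesis
    unfolding has_ito_integral_def using f' I' el lim
    by (intro conjI exI[of _ n] exI[of _ p] exI[of _ \<xi>]) auto
qed

lemma sem_process_modification:
  assumes h: "hurst_function T lo up h" and sem: "sem_process M F T B h g X"
    and g: "adapted_process F T g"
    and Y: "measurable_process M T Y" "adapted_process F T Y" and mod: "modification_of M T X Y"
  shows "sem_process M F T B h g Y"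
  unfolding sem_process_def
proof (intro conjI ballI Y)
  fix t assume t: "t \<in> {0..T}"
  have [measurable]: "h t \<in> borel_measurable borel"
  proof -
    obtain C where "0 < C" "\<And>x y. \<bar>h t x - h t y\<bar> \<le> C * \<bar>x - y\<bar>"
      using h t unfolding hurst_function_def by blast
    then have "C-lipschitz_on UNIV (h t)"
      by (intro lipschitz_onI) (auto simp: dist_real_def)
    then show ?thesis
      by (intro borel_measurable_continuous_onI lipschitz_on_continuous_on)
  qed
  let ?Rt = "restrict_space borel {0..t} :: real measure"
  have incl: "(\<lambda>r. r) \<in> measurable ?Rt (restrict_space borel {0..T})"
    using t by (intro measurable_restrict_space3) auto
  have id: "(\<lambda>r. r) \<in> measurable ?Rt borel"
    by (intro measurable_restrict_space1) simp
  have Y': "(\<lambda>(t, \<omega>). Y t \<omega>) \<in> borel_measurable (restrict_space borel {0..T} \<Otimes>\<^sub>M M)"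
    using Y(1) by (simp only: measurable_process_def)
  have pair: "(\<lambda>x. (fst x, snd x)) \<in> measurable (?Rt \<Otimes>\<^sub>M M) (restrict_space borel {0..T} \<Otimes>\<^sub>M M)"
    using measurable_compose[OF measurable_fst incl] by (intro measurable_Pair) auto
  have [measurable]: "(\<lambda>x. Y (fst x) (snd x)) \<in> borel_measurable (?Rt \<Otimes>\<^sub>M M)"
    using measurable_compose[OF pair Y'] by (simp only: prod.case)
  have [measurable]: "fst \<in> borel_measurable (?Rt \<Otimes>\<^sub>M M)"
    by (rule measurable_compose[OF measurable_fst id])
  have "(\<lambda>x. (t - fst x) powr (h t (Y (fst x) (snd x)) - 1 / 2)) \<in> borel_measurable (?Rt \<Otimes>\<^sub>M M)"
    by measurable
  then have meas: "measurable_process M t (\<lambda>s \<omega>. (t - s) powr (h t (Y s \<omega>) - 1/2))"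
    by (simp add: measurable_process_def case_prod_beta')
  have adapted: "adapted_process F t (\<lambda>s \<omega>. (t - s) powr (h t (Y s \<omega>) - 1/2))"
    unfolding adapted_process_def
  proof
    fix s assume "s \<in> {0..t}"
    then have [measurable]: "Y s \<in> borel_measurable (F s)"
      using Y(2) t by (auto simp: adapted_process_def)
    show "(\<lambda>\<omega>. (t - s) powr (h t (Y s \<omega>) - 1/2)) \<in> borel_measurable (F s)" by measurable
  qed
  show "has_ito_integral M F B t (\<lambda>s \<omega>. (t - s) powr (h t (Y s \<omega>) - 1/2)) (\<lambda>\<omega>. Y t \<omega> - g t \<omega>)"
  proof (rule has_ito_integral_cong_AE[OF _ t meas adapted])
    show "has_ito_integral M F B t (\<lambda>s \<omega>. (t - s) powr (h t (X s \<omega>) - 1/2)) (\<lambda>\<omega>. X t \<omega> - g t \<omega>)"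
      using sem t by (auto simp: sem_process_def)
    show "(\<lambda>\<omega>. Y t \<omega> - g t \<omega>) \<in> borel_measurable M"
      using Y(2) g t
      by (intro measurable_from_filtration[OF _ t] borel_measurable_diff) (simp_all add: adapted_process_def)
    show "AE \<omega> in M. (t - s) powr (h t (Y s \<omega>) - 1/2) = (t - s) powr (h t (X s \<omega>) - 1/2)"
      if "s \<in> {0..t}" for s
    proof -
      have "AE \<omega> in M. Y s \<omega> = X s \<omega>" using mod t that by (auto simp: modification_of_def)
      then show ?thesis by eventually_elim simp
    qed
    have "AE \<omega> in M. Y t \<omega> = X t \<omega>" using mod t by (auto simp: modification_of_def)
    then show "AE \<omega> in M. Y t \<omega> - g t \<omega> = X t \<omega> - g t \<omega>" by eventually_elim simp
  qed
qed

end

theorem proposition8: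
  fixes M :: "'a measure" and F :: "real \<Rightarrow> 'a measure"
    and B g X :: "real \<Rightarrow> 'a \<Rightarrow> real"
    and h :: "real \<Rightarrow> real \<Rightarrow> real"
    and T \<delta> h_lo h_up :: real
  assumes "T > 0"
    and "prob_space M"
    and "filtration_on M T F"
    and "brownian_motion M F T B"
    and "hurst_function T h_lo h_up h"
    and "adapted_process F T g"
    and "continuous_process M T g"
    and "\<delta> > 0"
    and "\<And>p::real. p \<ge> 2 \<Longrightarrow>
           (\<integral>\<^sup>+\<omega>. (SUP t\<in>{0..T}. ennreal (\<bar>g t \<omega>\<bar> powr p)) \<partial>M) < \<infinity>"
    and "\<And>p::real. p \<ge> 2 \<Longrightarrow>
           \<exists>C::real. \<forall>s\<in>{0..T}. \<forall>t\<in>{0..T}.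
             (\<integral>\<^sup>+\<omega>. ennreal (\<bar>g t \<omega> - g s \<omega>\<bar> powr p) \<partial>M)
               \<le> ennreal (C * \<bar>t - s\<bar> powr (\<delta> * p))"
    and "sem_process M F T B h g X"
  shows "(\<exists>Y. sem_process M F T B h g Y \<and> modification_of M T X Y \<and>
            (\<exists>N\<in>null_sets M. \<forall>\<omega>\<in>space M - N. \<forall>\<alpha>\<in>{0<..<min h_lo \<delta>}.
               holder_on \<alpha> {0..T} (\<lambda>t. Y t \<omega>)))
       \<and> (continuous_process M T X \<longrightarrow>
            (\<exists>N\<in>null_sets M. \<forall>\<omega>\<in>space M - N. \<forall>\<alpha>\<in>{0<..<min h_lo \<delta>}.
               holder_on \<alpha> {0..T} (\<lambda>t. X t \<omega>)))"
proof -
  interpret filtered_brownian_motion M F T B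
    using assms by (simp add: filtered_brownian_motion_def filtered_brownian_motion_axioms_def)
  have X: "measurable_process M T X" "adapted_process F T X"
    using assms(11) by (auto simp: sem_process_def)
  have X_meas: "X t \<in> borel_measurable M" if "t \<in> {0..T}" for t
    using X(2) that by (intro measurable_from_filtration[OF _ that]) (simp add: adapted_process_def)
  have \<kappa>: "0 < min h_lo \<delta>" using assms(5,8) by (auto simp: hurst_function_def)
  define Y where "Y = dyadic_limit T X"
  note moments = sem_increment_moment[OF assms(1,5,11,6,10)]
  have mod: "modification_of M T X Y"
    and holder: "AE \<omega> in M. \<forall>\<alpha>\<in>{0<..<min h_lo \<delta>}. holder_on \<alpha> {0..T} (\<lambda>t. Y t \<omega>)"
    unfolding Y_def
    using kolmogorov_holder_modification[OF assms(1) X_meas \<kappa> moments] by auto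
  have "measurable_process M T Y" "adapted_process F T Y"
    unfolding Y_def
    by (rule dyadic_limit_measurable[OF assms(1) X(1)], rule dyadic_limit_adapted[OF assms(1,3) X(2)])
  then have sem_Y: "sem_process M F T B h g Y"
    by (rule sem_process_modification[OF assms(5,11,6) _ _ mod])
  have null: "\<exists>N\<in>null_sets M. \<forall>\<omega>\<in>space M - N. P \<omega>" if P: "AE \<omega> in M. P \<omega>" for P
  proof -
    obtain N where N: "N \<in> null_sets M" "{\<omega> \<in> space M. \<not> P \<omega>} \<subseteq> N"
      using P by (auto simp only: eventually_ae_filter)
    show ?thesis
      by (rule bexI[OF _ N(1)]) (use N(2) in auto)
  qed
  have holder_X: "AE \<omega> in M. \<forall>\<alpha>\<in>{0<..<min h_lo \<delta>}. holder_on \<alpha> {0..T} (\<lambda>t. X t \<omega>)"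
    if "continuous_process M T X"
    using holder that unfolding continuous_process_def
  proof eventually_elim
    case (elim \<omega>)
    then have "Y t \<omega> = X t \<omega>" if "t \<in> {0..T}" for t
      unfolding Y_def using that assms(1) by (intro dyadic_limit_eq_if_continuous)
    then show ?case using elim(1) unfolding holder_on_def by simp
  qed
  show ?thesis
    by (intro conjI impI exI[of _ Y] sem_Y mod null[OF holder] null[OF holder_X])
qed

end
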